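(* For all non-negative integers $m$ and $n$, $$\mathrm{M}(C_{2m+1,2n})=\prod_{k=1}^{n}\ \prod_{j\in\{1,3,\dots,2m+1\}}\Big(4\cos^2\frac{j\pi}{4m+2}+4\cos^2\frac{k\pi}{2n+1}\Big).$$
   Context: The square cylinder graph $C_{M,N}$ is obtained from the $M\times N$ grid graph with vertex set $\{(i,j)\in\mathbb Z^2: 0\le i\le M-1,\ 0\le j\le N-1\}$ (vertices adjacent when at distance $1$) by adding, for each $j=0,\dots,N-1$, an edge joining $(0,j)$ to $(M-1,j)$ (loops when $M=1$, which play no role in perfect matchings); for $N=0$ it is the empty graph. $\mathrm{M}(G)$ denotes the number of perfect matchings of $G$. *)

theory Defs
  imports "HOL-Analysis.Analysis"
begin

text \<open>Undirected multigraphs with loops allowed: every edge has a set of endpoints, which is a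
  singleton for a loop. Parallel edges are distinct edges with the same endpoints.\<close>

record ('v, 'e) multigraph =
  vertices :: "'v set"
  edges :: "'e set"
  endpoints :: "'e \<Rightarrow> 'v set"

text \<open>Loops are excluded explicitly: otherwise a loop would meet the condition that its vertex is
  covered exactly once.\<close>

definition perfect_matching :: "('v, 'e) multigraph \<Rightarrow> 'e set \<Rightarrow> bool" where
  "perfect_matching G S \<longleftrightarrow>
     S \<subseteq> edges G \<and>
     (\<forall>e\<in>S. card (endpoints G e) = 2) \<and>
     (\<forall>v\<in>vertices G. \<exists>!e. e \<in> S \<and> v \<in> endpoints G e)"

definition num_perfect_matchings :: "('v, 'e) multigraph \<Rightarrow> nat" where
  "num_perfect_matchings G = card {S. perfect_matching G S}"

definition grid_vertices :: "nat \<Rightarrow> nat \<Rightarrow> (int \<times> int) set" where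
  "grid_vertices M N = {(i, j). 0 \<le> i \<and> i \<le> int M - 1 \<and> 0 \<le> j \<and> j \<le> int N - 1}"

text \<open>Two vertices are adjacent when their Euclidean distance, here its square, is 1.\<close>

definition grid_edges :: "nat \<Rightarrow> nat \<Rightarrow> (int \<times> int) set set" where
  "grid_edges M N = {{(i, j), (i', j')} | i j i' j'.
     (i, j) \<in> grid_vertices M N \<and> (i', j') \<in> grid_vertices M N \<and>
     (i - i')\<^sup>2 + (j - j')\<^sup>2 = 1}"

definition wrap_edges :: "nat \<Rightarrow> nat \<Rightarrow> (int \<times> int) set set" where
  "wrap_edges M N = {{(0, j), (int M - 1, j)} | j.
     (0, j) \<in> grid_vertices M N \<and> (int M - 1, j) \<in> grid_vertices M N}"

text \<open>The boolean tag separates the grid edges from the added ones, so that an added edge is new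
  even when it is parallel to a grid edge (which happens for \<open>M = 2\<close>). For \<open>M = 1\<close> the added
  edges are loops.\<close>

definition cylinder :: "nat \<Rightarrow> nat \<Rightarrow> (int \<times> int, bool \<times> (int \<times> int) set) multigraph" where
  "cylinder M N =
     \<lparr>vertices = grid_vertices M N,
      edges = {False} \<times> grid_edges M N \<union> {True} \<times> wrap_edges M N,
      endpoints = snd\<rparr>"

end

theory Submission
  imports Defs "HOL-Computational_Algebra.Polynomial"
begin

text \<open>Cut the cylinder into its \<open>L = 2m + 1\<close> columns, each a path on \<open>H = 2n\<close> sites. The number of
  perfect matchings is the trace of \<open>T^L\<close>, where \<open>T = C V\<close> acts on functions of the set of horizontal
  edges between two columns: \<open>V\<close> inserts vertical dimers and \<open>C\<close> is complementation. With
  Jordan-Wigner signs, \<open>V\<close> is the exponential of a quadratic form in fermionic creation operators, and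
  \<open>C\<close> is a product of sums of one creation and one annihilation operator. An orthogonal change of modes
  that mixes only sites of equal parity brings the quadratic form to its singular value form with singular
  values \<open>2 cos(k pi/(2n+1))\<close> and preserves \<open>C\<close> up to a sign, by Schur's lemma. So \<open>T\<close> becomes, up to
  sign, a product of \<open>n\<close> commuting transfer operators of ladders with two sites, and
  the trace factors into Lucas numbers. The case \<open>L = 1\<close>, where the trace is 1, determines the sign.\<close>

section \<open>Operators on the fermionic Fock space\<close>

text \<open>Parity is the key constraint. Conjugation by the complementation \<open>C\<close> turns
  the annihilator of site \<open>i\<close> into \<open>(-1) ^ i\<close> times its creator, so a
  combination of annihilators goes to the same combination of creators, up to sign, only if its
  sites have equal parity. The path allows this because each dimer joins an even and an odd site:
  the quadratic form in \<open>V\<close> pairs the two halves, and a singular value decomposition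
  uses one orthogonal matrix on each half.

  The number \<open>L\<close> of columns has to be odd for two reasons: the unknown sign
  \<open>s\<close> then satisfies \<open>s ^ L = s\<close>, and on the singly occupied states of a
  ladder the operator is a transposition, whose odd powers have trace 0 while its even powers have
  trace 2.

  Fixing the sign also supplies a missing factor. One column gives
  \<open>1 = s * (\<Prod>k<n. \<mu> k)\<close>, and multiplying the trace by this turns each Lucas
  value into \<open>\<mu> * lucas \<mu> (2 * m + 1)\<close>. The formula needs this extra
  \<open>\<mu>\<close>: its factor with \<open>j = 2 * m + 1\<close> has a vanishing cosine and
  contributes \<open>\<mu>\<^sup>2\<close>.\<close>

text \<open>A basis state is the set of occupied sites. Arbitrary functions on all sets of naturals are allowed, so
  that the operators form a ring independent of the number of sites; the Fock space on \<open>H\<close> sites is cut out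
  below by the predicate \<open>supported H\<close>.\<close>

typedef fock_op = "{X :: (nat set \<Rightarrow> real) \<Rightarrow> nat set \<Rightarrow> real.
    (\<forall>f g. X (\<lambda>S. f S + g S) = (\<lambda>S. X f S + X g S)) \<and>
    (\<forall>r f. X (\<lambda>S. r * f S) = (\<lambda>S. r * X f S))}"
  morphisms app Fock_op
  by (rule exI[of _ "\<lambda>f. f"]) simp

setup_lifting type_definition_fock_op

instantiation fock_op :: real_algebra_1
begin

lift_definition zero_fock_op :: fock_op is "\<lambda>f S. 0" by simp
lift_definition one_fock_op :: fock_op is "\<lambda>f. f" by simp
lift_definition plus_fock_op :: "fock_op \<Rightarrow> fock_op \<Rightarrow> fock_op" is "\<lambda>X Y f S. X f S + Y f S"
  by (simp add: algebra_simps)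
lift_definition minus_fock_op :: "fock_op \<Rightarrow> fock_op \<Rightarrow> fock_op" is "\<lambda>X Y f S. X f S - Y f S"
  by (simp add: algebra_simps)
lift_definition uminus_fock_op :: "fock_op \<Rightarrow> fock_op" is "\<lambda>X f S. - X f S"
  by simp
lift_definition times_fock_op :: "fock_op \<Rightarrow> fock_op \<Rightarrow> fock_op" is "\<lambda>X Y f. X (Y f)"
  by simp
lift_definition scaleR_fock_op :: "real \<Rightarrow> fock_op \<Rightarrow> fock_op" is "\<lambda>r X f S. r * X f S"
  by (simp add: algebra_simps)

instance
proof
  show "(0::fock_op) \<noteq> 1"
    by transfer (metis zero_neq_one)
qed (transfer; simp add: algebra_simps)+

end

lemma app_add [simp]: "app (X + Y) f S = app X f S + app Y f S"
  by transfer simp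
lemma app_minus [simp]: "app (- X) f S = - app X f S"
  by transfer simp
lemma app_zero [simp]: "app 0 f S = 0"
  by transfer simp
lemma app_one [simp]: "app 1 f = f"
  by transfer simp
lemma app_mult [simp]: "app (X * Y) f = app X (app Y f)"
  by transfer simp
lemma app_scaleR [simp]: "app (r *\<^sub>R X) f S = r * app X f S"
  by transfer simp
lemma app_arg_add: "app X (\<lambda>S. f S + g S) = (\<lambda>S. app X f S + app X g S)"
  by transfer simp
lemma app_arg_scale: "app X (\<lambda>S. r * f S) = (\<lambda>S. r * app X f S)"
  by transfer simp

lemma app_arg_zero: "app X (\<lambda>S. 0) = (\<lambda>S. 0)"
  using app_arg_scale[of X 0 "\<lambda>S. 0"] by simp

lemma app_arg_sum:
  "app X (\<lambda>S. \<Sum>a\<in>A. f a S) = (\<lambda>S. \<Sum>a\<in>A. app X (f a) S)"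
  by (induction A rule: infinite_finite_induct) (simp_all add: app_arg_zero app_arg_add)

lemma fock_op_eqI: "(\<And>f S. app X f S = app Y f S) \<Longrightarrow> X = Y"
  by (metis app_inject ext)

definition jw_sign :: "nat \<Rightarrow> nat set \<Rightarrow> real" where
  "jw_sign i S = (-1) ^ card (S \<inter> {..<i})"

text \<open>Operators act on coefficient functions: for \<open>i\<close> outside \<open>S\<close>,
  the point function of \<open>S\<close> goes to that of \<open>insert i S\<close> up to sign, so
  the value at a set is read off from the smaller set.\<close>

lift_definition create :: "nat \<Rightarrow> fock_op" is
  "\<lambda>i f S. if i \<in> S then jw_sign i S * f (S - {i}) else 0"
  by (auto simp: algebra_simps fun_eq_iff)

lift_definition annihilate :: "nat \<Rightarrow> fock_op" is
  "\<lambda>i f S. if i \<notin> S then jw_sign i S * f (insert i S) else 0"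
  by (auto simp: algebra_simps fun_eq_iff)

lemma app_create: "app (create i) f S = (if i \<in> S then jw_sign i S * f (S - {i}) else 0)"
  by transfer simp

lemma app_annihilate: "app (annihilate i) f S = (if i \<notin> S then jw_sign i S * f (insert i S) else 0)"
  by transfer simp

lemma jw_sign_sq [simp]: "jw_sign i S * jw_sign i S = 1" "jw_sign i S * (jw_sign i S * x) = x"
  by (simp_all add: jw_sign_def flip: power_add mult.assoc)

lemma jw_sign_insert: "j \<notin> S \<Longrightarrow> jw_sign i (insert j S) = (if j < i then - jw_sign i S else jw_sign i S)"
  by (auto simp: jw_sign_def Int_insert_left)

lemma jw_sign_remove: "j \<in> S \<Longrightarrow> jw_sign i (S - {j}) = (if j < i then - jw_sign i S else jw_sign i S)"
  using jw_sign_insert[of j "S - {j}" i] by (auto simp: insert_absorb split: if_splits)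

text \<open>The canonical anticommutation relations for annihilators \<open>d\<close> and creators \<open>d'\<close>.\<close>

definition car :: "nat \<Rightarrow> (nat \<Rightarrow> 'a::real_algebra_1) \<Rightarrow> (nat \<Rightarrow> 'a) \<Rightarrow> bool" where
  "car N d d' \<longleftrightarrow> (\<forall>i<N. \<forall>j<N.
     d i * d j = - (d j * d i) \<and> d' i * d' j = - (d' j * d' i) \<and>
     d i * d' j = of_bool (i = j) - d' j * d i)"

lemma car_annihilate_create: "car N annihilate create"
  unfolding car_def
proof (intro allI impI conjI)
  fix i j
  show "annihilate i * annihilate j = - (annihilate j * annihilate i)"
    by (cases "i = j"; rule fock_op_eqI) (auto simp: app_annihilate jw_sign_insert insert_commute)
  show "create i * create j = - (create j * create i)"
  proof (cases "i = j")
    case False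
    moreover have "S - {i} - {j} = S - {j} - {i}" for S :: "nat set" by auto
    ultimately show ?thesis by (intro fock_op_eqI) (auto simp: app_create jw_sign_remove)
  qed (auto intro!: fock_op_eqI simp: app_create)
  show "annihilate i * create j = of_bool (i = j) - create j * annihilate i"
  proof (cases "i = j")
    case False
    then have "insert i S - {j} = insert i (S - {j})" for S by auto
    with False show ?thesis
      by (intro fock_op_eqI) (auto simp: app_create app_annihilate jw_sign_insert jw_sign_remove)
  qed (auto intro!: fock_op_eqI simp: app_create app_annihilate jw_sign_insert jw_sign_remove insert_absorb
      simp flip: add_uminus_conv_diff)
qed

section \<open>The space of finitely many sites and its trace\<close>

definition supported :: "nat \<Rightarrow> (nat set \<Rightarrow> real) \<Rightarrow> bool" where
  "supported H f \<longleftrightarrow> (\<forall>S. f S \<noteq> 0 \<longrightarrow> S \<subseteq> {..<H})"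

text \<open>Operators act on functions of all sets of naturals, whereas trace arguments and Schur's
  lemma live on a finite-dimensional subspace; each operator involved has to map that subspace into
  itself.\<close>

definition preserves :: "nat \<Rightarrow> fock_op \<Rightarrow> bool" where
  "preserves H X \<longleftrightarrow> (\<forall>f. supported H f \<longrightarrow> supported H (app X f))"

definition point_fn :: "nat set \<Rightarrow> nat set \<Rightarrow> real" where
  "point_fn S = (\<lambda>R. of_bool (R = S))"

definition fock_trace :: "nat \<Rightarrow> fock_op \<Rightarrow> real" where
  "fock_trace H X = (\<Sum>S\<in>Pow {..<H}. app X (point_fn S) S)"

lemma supported_point_fn: "S \<subseteq> {..<H} \<Longrightarrow> supported H (point_fn S)"
  by (auto simp: supported_def point_fn_def)

lemma supported_expand:
  assumes "supported H f"
  shows "f = (\<lambda>R. \<Sum>S\<in>Pow {..<H}. f S * point_fn S R)"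
proof
  fix R
  have "(\<Sum>S\<in>Pow {..<H}. f S * point_fn S R) = (\<Sum>S\<in>Pow {..<H}. if S = R then f R else 0)"
    by (intro sum.cong) (auto simp: point_fn_def)
  also have "\<dots> = f R"
    using assms by (auto simp: supported_def)
  finally show "f R = (\<Sum>S\<in>Pow {..<H}. f S * point_fn S R)" by simp
qed

lemma app_expand:
  assumes "supported H f"
  shows "app X f R = (\<Sum>S\<in>Pow {..<H}. f S * app X (point_fn S) R)"
proof -
  have "app X f R = app X (\<lambda>R. \<Sum>S\<in>Pow {..<H}. f S * point_fn S R) R"
    using supported_expand[OF assms] by (rule arg_cong)
  then show ?thesis by (simp add: app_arg_sum app_arg_scale)
qed

text \<open>Inserting the basis between the factors gives a double sum of matrix entries. This is
  legitimate because the inner factor keeps its image in the span of the point functions.\<close>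

lemma fock_trace_cyclic:
  assumes "preserves H X" "preserves H Y"
  shows "fock_trace H (X * Y) = fock_trace H (Y * X)"
proof -
  have *: "fock_trace H (X * Y) =
      (\<Sum>S\<in>Pow {..<H}. \<Sum>R\<in>Pow {..<H}. app Y (point_fn S) R * app X (point_fn R) S)"
    if "preserves H Y" for X Y
    unfolding fock_trace_def
    by (intro sum.cong refl) (use that in \<open>auto simp: preserves_def supported_point_fn app_expand[of H]\<close>)
  show ?thesis
    unfolding *[OF assms(1)] *[OF assms(2)] by (subst sum.swap) (simp add: mult.commute)
qed

lemma preserves_one [simp, intro]: "preserves H 1"
  by (simp add: preserves_def)

lemma preserves_zero [simp, intro]: "preserves H 0"
  by (simp add: preserves_def supported_def)

lemma preserves_add [simp, intro]: "preserves H X \<Longrightarrow> preserves H Y \<Longrightarrow> preserves H (X + Y)"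
  unfolding preserves_def supported_def app_add by (metis add.right_neutral)

lemma preserves_mult [simp, intro]: "preserves H X \<Longrightarrow> preserves H Y \<Longrightarrow> preserves H (X * Y)"
  by (simp add: preserves_def)

lemma preserves_scaleR [simp, intro]: "preserves H X \<Longrightarrow> preserves H (r *\<^sub>R X)"
  by (simp add: preserves_def supported_def)

lemma preserves_uminus [simp, intro]: "preserves H X \<Longrightarrow> preserves H (- X)"
  by (simp add: preserves_def supported_def)

lemma preserves_diff [simp, intro]: "preserves H X \<Longrightarrow> preserves H Y \<Longrightarrow> preserves H (X - Y)"
  by (simp flip: add_uminus_conv_diff)

lemma preserves_power [simp, intro]: "preserves H X \<Longrightarrow> preserves H (X ^ k)"
  by (induction k) auto

lemma preserves_sum [simp, intro]: "(\<And>a. a \<in> A \<Longrightarrow> preserves H (f a)) \<Longrightarrow> preserves H (\<Sum>a\<in>A. f a)"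
  by (induction A rule: infinite_finite_induct) auto

lemma preserves_create [simp, intro]:
  assumes "i < H" shows "preserves H (create i)"
  unfolding preserves_def supported_def app_create
proof (intro allI impI)
  fix f :: "nat set \<Rightarrow> real" and S
  assume "\<forall>S. f S \<noteq> 0 \<longrightarrow> S \<subseteq> {..<H}" and "(if i \<in> S then jw_sign i S * f (S - {i}) else 0) \<noteq> 0"
  then have "S - {i} \<subseteq> {..<H}" by (metis mult_zero_right)
  with assms show "S \<subseteq> {..<H}" by auto
qed

lemma preserves_annihilate [simp, intro]: "preserves H (annihilate i)"
  unfolding preserves_def supported_def app_annihilate
proof (intro allI impI)
  fix f :: "nat set \<Rightarrow> real" and S
  assume "\<forall>S. f S \<noteq> 0 \<longrightarrow> S \<subseteq> {..<H}" and "(if i \<notin> S then jw_sign i S * f (insert i S) else 0) \<noteq> 0"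
  then have "insert i S \<subseteq> {..<H}" by (metis mult_zero_right)
  then show "S \<subseteq> {..<H}" by auto
qed

lemma fock_trace_add: "fock_trace H (X + Y) = fock_trace H X + fock_trace H Y"
  by (simp add: fock_trace_def sum.distrib)

lemma fock_trace_scaleR: "fock_trace H (r *\<^sub>R X) = r * fock_trace H X"
  by (simp add: fock_trace_def sum_distrib_left)

lemma fock_trace_uminus: "fock_trace H (- X) = - fock_trace H X"
  by (simp add: fock_trace_def sum_negf)

lemma fock_trace_diff: "fock_trace H (X - Y) = fock_trace H X - fock_trace H Y"
  by (simp add: fock_trace_add fock_trace_uminus flip: add_uminus_conv_diff)

lemma fock_trace_one: "fock_trace H 1 = 2 ^ H"
  by (simp add: fock_trace_def point_fn_def card_Pow)

section \<open>Ordered products and truncated exponentials in a noncommutative ring\<close>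

primrec ordered_prod :: "(nat \<Rightarrow> 'a::monoid_mult) \<Rightarrow> nat \<Rightarrow> 'a" where
  "ordered_prod x 0 = 1"
| "ordered_prod x (Suc k) = ordered_prod x k * x k"

lemma preserves_ordered_prod [simp, intro]: "(\<And>i. i < k \<Longrightarrow> preserves H (x i)) \<Longrightarrow> preserves H (ordered_prod x k)"
  by (induction k) auto

lemma ordered_prod_commute:
  assumes "\<And>i. i < k \<Longrightarrow> x i * y = y * x i"
  shows "ordered_prod x k * y = y * ordered_prod x k"
  using assms
proof (induction k)
  case (Suc k)
  have "ordered_prod x (Suc k) * y = ordered_prod x k * y * x k"
    by (simp add: mult.assoc Suc.prems)
  with Suc show ?case by (simp add: mult.assoc)
qed simp

lemma power_mult_distrib_commute:
  fixes x y :: "'a::monoid_mult"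
  assumes "x * y = y * x"
  shows "(x * y) ^ l = x ^ l * y ^ l"
proof (induction l)
  case (Suc l)
  have "(x * y) ^ Suc l = x * (y * x ^ l) * y ^ l"
    by (simp add: Suc mult.assoc)
  also have "y * x ^ l = x ^ l * y"
    by (metis assms power_commuting_commutes)
  finally show ?case by (simp add: mult.assoc)
qed simp

lemma ordered_prod_power:
  assumes "\<And>i j. i < k \<Longrightarrow> j < k \<Longrightarrow> x i * x j = x j * x i"
  shows "ordered_prod x k ^ l = ordered_prod (\<lambda>i. x i ^ l) k"
  using assms
proof (induction k)
  case (Suc k)
  have "ordered_prod x k * x k = x k * ordered_prod x k"
    by (rule ordered_prod_commute) (simp add: Suc.prems)
  then have "ordered_prod x (Suc k) ^ l = ordered_prod x k ^ l * x k ^ l"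
    unfolding ordered_prod.simps by (rule power_mult_distrib_commute)
  with Suc.IH Suc.prems show ?case by simp
qed simp

lemma ordered_prod_mult:
  assumes "\<And>i j. i < k \<Longrightarrow> j < k \<Longrightarrow> i \<noteq> j \<Longrightarrow> x i * y j = y j * x i"
  shows "ordered_prod x k * ordered_prod y k = ordered_prod (\<lambda>i. x i * y i) k"
  using assms
proof (induction k)
  case (Suc k)
  have "ordered_prod y k * x k = x k * ordered_prod y k"
    by (rule ordered_prod_commute) (simp add: Suc.prems)
  then have "ordered_prod x (Suc k) * ordered_prod y (Suc k) = ordered_prod x k * ordered_prod y k * (x k * y k)"
    by (simp add: mult.assoc) (simp flip: mult.assoc)
  with Suc.IH Suc.prems show ?case by simp
qed simp

text \<open>The binomial expansion stops after the linear term because \<open>x\<close> commutes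
  with \<open>a\<close> and has square zero.\<close>

lemma add_power_square_zero:
  fixes a x :: "'a::ring_1"
  assumes "a * x = x * a" "x * x = 0"
  shows "(a + x) ^ Suc r = a ^ Suc r + of_nat (Suc r) * (a ^ r * x)"
proof (induction r)
  case (Suc r)
  have nat: "y * (of_nat m * z) = of_nat m * (y * z)" for y z :: 'a and m
    by (metis mult.assoc mult_of_nat_commute)
  have c: "a ^ r * x = x * a ^ r"
    using assms(1) by (metis power_commuting_commutes)
  have x0: "x * (a ^ r * x) = 0"
    unfolding c using assms(2) by (simp flip: mult.assoc)
  have c': "x * a ^ Suc r = a ^ Suc r * x"
    using assms(1) by (metis power_commuting_commutes)
  have "(a + x) ^ Suc (Suc r) = (a + x) * (a ^ Suc r + of_nat (Suc r) * (a ^ r * x))"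
    unfolding Suc[symmetric] by (rule power_Suc)
  also have "\<dots> = a ^ Suc (Suc r) + a * (of_nat (Suc r) * (a ^ r * x)) + x * a ^ Suc r
      + x * (of_nat (Suc r) * (a ^ r * x))"
    by (simp add: algebra_simps)
  also have "a * (of_nat (Suc r) * (a ^ r * x)) = of_nat (Suc r) * (a ^ Suc r * x)"
    by (simp only: nat power_Suc mult.assoc)
  also have "x * (of_nat (Suc r) * (a ^ r * x)) = of_nat (Suc r) * (x * (a ^ r * x))"
    by (rule nat)
  finally show ?case unfolding x0 c' by (simp add: algebra_simps)
qed simp

text \<open>Both sides are the exponential of the sum of the \<open>x i\<close>.\<close>

lemma ordered_prod_one_plus:
  fixes x :: "nat \<Rightarrow> 'a::real_algebra_1"
  assumes "\<And>i j. i < k \<Longrightarrow> j < k \<Longrightarrow> x i * x j = x j * x i"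
    and "\<And>i. i < k \<Longrightarrow> x i * x i = 0"
  shows "(\<Sum>i<k. x i) ^ Suc k = 0 \<and>
    ordered_prod (\<lambda>i. 1 + x i) k = (\<Sum>r\<le>k. (\<Sum>i<k. x i) ^ r /\<^sub>R fact r)"
  using assms
proof (induction k)
  case (Suc k)
  define a where "a = (\<Sum>i<k. x i)"
  have ax: "a * x k = x k * a"
    unfolding a_def by (simp add: sum_distrib_left sum_distrib_right Suc.prems)
  have xx: "x k * x k = 0" by (simp add: Suc.prems)
  note pow = add_power_square_zero[OF ax xx]
  have a0: "a ^ Suc k = 0" and IH: "ordered_prod (\<lambda>i. 1 + x i) k = (\<Sum>r\<le>k. a ^ r /\<^sub>R fact r)"
    using Suc unfolding a_def by auto
  \<comment> \<open>Division by the factorial turns the linear term into the previous summand times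
    \<open>x k\<close>, so the sum becomes the exponential of \<open>a\<close> times
    \<open>1 + x k\<close>.\<close>
  have summand: "(a + x k) ^ Suc r /\<^sub>R fact (Suc r) = a ^ Suc r /\<^sub>R fact (Suc r) + (a ^ r /\<^sub>R fact r) * x k" for r
  proof -
    have "of_nat (Suc r) * (a ^ r * x k) = real (Suc r) *\<^sub>R (a ^ r * x k)"
      by (metis of_real_of_nat_eq scaleR_conv_of_real)
    then show ?thesis
      unfolding pow by (simp add: scaleR_add_right field_simps del: of_nat_Suc power_Suc)
  qed
  have "(\<Sum>r\<le>Suc k. (a + x k) ^ r /\<^sub>R fact r)
      = 1 + (\<Sum>r\<le>k. a ^ Suc r /\<^sub>R fact (Suc r)) + (\<Sum>r\<le>k. a ^ r /\<^sub>R fact r) * x k"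
    by (subst sum.atMost_Suc_shift) (simp only: summand sum.distrib sum_distrib_right, simp)
  also have "1 + (\<Sum>r\<le>k. a ^ Suc r /\<^sub>R fact (Suc r)) = (\<Sum>r\<le>Suc k. a ^ r /\<^sub>R fact r)"
    using sum.atMost_Suc_shift[of "\<lambda>r. a ^ r /\<^sub>R fact r" k] by simp
  also have "\<dots> = (\<Sum>r\<le>k. a ^ r /\<^sub>R fact r)"
    by (simp add: a0 del: power_Suc)
  finally have "(\<Sum>r\<le>Suc k. (a + x k) ^ r /\<^sub>R fact r) = ordered_prod (\<lambda>i. 1 + x i) (Suc k)"
    by (simp add: IH algebra_simps)
  moreover have "(a + x k) ^ Suc (Suc k) = 0"
    unfolding pow using a0 by simp
  ultimately show ?case by (simp add: a_def)
qed simp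

text \<open>Both products are exponentials of one nilpotent element, each truncated at its own
  length. This is how the \<open>2 * n - 1\<close> bonds of the path get replaced by
  \<open>n\<close> pairs of modes.\<close>

lemma ordered_prod_one_plus_cong:
  fixes x y :: "nat \<Rightarrow> 'a::real_algebra_1"
  assumes "\<And>i j. i < k \<Longrightarrow> j < k \<Longrightarrow> x i * x j = x j * x i" "\<And>i. i < k \<Longrightarrow> x i * x i = 0"
    and "\<And>i j. i < l \<Longrightarrow> j < l \<Longrightarrow> y i * y j = y j * y i" "\<And>i. i < l \<Longrightarrow> y i * y i = 0"
    and "(\<Sum>i<k. x i) = (\<Sum>i<l. y i)"
  shows "ordered_prod (\<lambda>i. 1 + x i) k = ordered_prod (\<lambda>i. 1 + y i) l"
proof -
  define a where "a = (\<Sum>i<k. x i)"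
  have x: "a ^ Suc k = 0" "ordered_prod (\<lambda>i. 1 + x i) k = (\<Sum>r\<le>k. a ^ r /\<^sub>R fact r)"
    using ordered_prod_one_plus[of k x] assms(1,2) by (auto simp: a_def)
  have y: "a ^ Suc l = 0" "ordered_prod (\<lambda>i. 1 + y i) l = (\<Sum>r\<le>l. a ^ r /\<^sub>R fact r)"
    using ordered_prod_one_plus[of l y] assms(3,4) by (auto simp: a_def assms(5))
  \<comment> \<open>Terms beyond the nilpotency order vanish, so the longer of the two truncations
    equals the shorter.\<close>
  have *: "(\<Sum>r\<le>N. a ^ r /\<^sub>R fact r) = (\<Sum>r\<le>M. a ^ r /\<^sub>R fact r)"
    if "a ^ Suc M = 0" "M \<le> N" for M N
  proof (rule sum.mono_neutral_right)
    show "\<forall>i\<in>{..N} - {..M}. a ^ i /\<^sub>R fact i = 0"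
    proof
      fix i assume "i \<in> {..N} - {..M}"
      then have "a ^ i = a ^ Suc M * a ^ (i - Suc M)"
        by (simp flip: power_add del: power_Suc)
      with that(1) show "a ^ i /\<^sub>R fact i = 0" by simp
    qed
  qed (use that in auto)
  show ?thesis
    using *[of k l] *[of l k] x y by (cases "k \<le> l") auto
qed

text \<open>The vacuum is the only state killed by all annihilators, and creators generate everything from it.\<close>

lemma schur:
  assumes "preserves H X" "\<And>i. i < H \<Longrightarrow> X * annihilate i = annihilate i * X" "\<And>i. i < H \<Longrightarrow> X * create i = create i * X"
  obtains s where "\<And>f. supported H f \<Longrightarrow> app X f = (\<lambda>S. s * f S)"
proof -
  define v where "v = app X (point_fn {})"
  define s where "s = v {}"
  have "supported H v"
    unfolding v_def using assms(1) by (simp add: preserves_def supported_point_fn)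
  have "v S = 0" if "S \<noteq> {}" for S
  proof (cases "S \<subseteq> {..<H}")
    case True
    with that obtain i where i: "i \<in> S" "i < H" by auto
    have "app (annihilate i) (point_fn {}) = (\<lambda>S. 0)"
      by (auto simp: app_annihilate point_fn_def)
    then have "app (annihilate i) v = (\<lambda>S. 0)"
      unfolding v_def by (metis app_arg_zero app_mult assms(2) i(2))
    then have "app (annihilate i) v (S - {i}) = 0" by simp
    with i show ?thesis by (simp add: app_annihilate insert_absorb jw_sign_def)
  qed (use \<open>supported H v\<close> in \<open>auto simp: supported_def\<close>)
  then have v: "v = (\<lambda>S. s * point_fn {} S)"
    by (auto simp: s_def point_fn_def)
  have X: "app X (point_fn S) = (\<lambda>R. s * point_fn S R)" if "finite S" "S \<subseteq> {..<H}" for S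
    using that
  proof (induction S rule: finite_induct)
    case empty
    then show ?case using v by (simp add: v_def)
  next
    case (insert i S)
    have "insert i S = R" if "R - {i} = S" "i \<in> R" for R
      using that by auto
    then have e: "point_fn (insert i S) = (\<lambda>R. jw_sign i S * app (create i) (point_fn S) R)"
      using insert by (auto simp: app_create point_fn_def fun_eq_iff jw_sign_insert)
    have "app X (app (create i) (point_fn S)) = app (create i) (app X (point_fn S))"
      using assms(3)[of i] insert.prems by (metis app_mult insert_subset lessThan_iff)
    also have "app X (point_fn S) = (\<lambda>R. s * point_fn S R)"
      using insert by simp
    finally show ?case
      unfolding e app_arg_scale by (auto simp: fun_eq_iff mult_ac)
  qed
  have "app X f R = s * f R" if "supported H f" for f R
  proof -
    have "app X f R = (\<Sum>S\<in>Pow {..<H}. f S * (s * point_fn S R))"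
      unfolding app_expand[OF that, of X R]
      by (intro sum.cong refl) (simp add: X finite_subset[OF _ finite_lessThan])
    also have "\<dots> = s * (\<Sum>S\<in>Pow {..<H}. f S * point_fn S R)"
      by (simp add: sum_distrib_left mult_ac)
    also have "(\<Sum>S\<in>Pow {..<H}. f S * point_fn S R) = f R"
      using fun_cong[OF supported_expand[OF that], of R] by simp
    finally show ?thesis .
  qed
  with that show ?thesis by blast
qed

section \<open>Complementation as a product of fermions\<close>

lemma eq_uminus_iff_zero: "(x::'a::real_vector) = - x \<longleftrightarrow> x = 0"
proof
  assume "x = - x"
  then have "x + x = 0" by (metis add.right_inverse)
  then have "2 *\<^sub>R x = 0" by (simp add: scaleR_2)
  then show "x = 0" by simp
qed simp

lemma car_simps:
  assumes "car N d d'" "i < N" "j < N"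
  shows "d i * d j = - (d j * d i)" "d' i * d' j = - (d' j * d' i)"
    "d i * d' j = of_bool (i = j) - d' j * d i"
    "d i * d i = 0" "d' i * d' i = 0"
proof -
  show "d i * d j = - (d j * d i)" "d' i * d' j = - (d' j * d' i)"
    "d i * d' j = of_bool (i = j) - d' j * d i"
    using assms unfolding car_def by blast+
  have "d i * d i = - (d i * d i)" "d' i * d' i = - (d' i * d' i)"
    using assms unfolding car_def by blast+
  then show "d i * d i = 0" "d' i * d' i = 0"
    by (simp_all add: eq_uminus_iff_zero)
qed

text \<open>The opposite signs in the two factors make the Jordan-Wigner signs of neighbouring sites cancel, so that
  \<open>flip_pair\<close> complements the occupation of two sites without a sign (lemma \<open>app_flip_pair\<close>).\<close>

definition flip_pair :: "'a::ring_1 \<Rightarrow> 'a \<Rightarrow> 'a \<Rightarrow> 'a \<Rightarrow> 'a" where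
  "flip_pair x x' y y' = (x' - x) * (y' + y)"

definition flip_all :: "nat \<Rightarrow> (nat \<Rightarrow> 'a::ring_1) \<Rightarrow> (nat \<Rightarrow> 'a) \<Rightarrow> 'a" where
  "flip_all n d d' = ordered_prod (\<lambda>k. flip_pair (d (2 * k)) (d' (2 * k)) (d (2 * k + 1)) (d' (2 * k + 1))) n"

definition anticommute :: "'a::ring_1 \<Rightarrow> 'a \<Rightarrow> bool" where
  "anticommute x y \<longleftrightarrow> x * y = - (y * x)"

lemma anticommute_commute_pair:
  assumes "anticommute x z" "anticommute y z" shows "(x * y) * z = z * (x * y)"
proof -
  have "(x * y) * z = - (x * z * y)" using assms(2) by (simp add: anticommute_def mult.assoc)
  also have "\<dots> = z * (x * y)" using assms(1) by (simp add: anticommute_def mult.assoc)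
  finally show ?thesis .
qed

lemma anticommute_add: "anticommute x z \<Longrightarrow> anticommute y z \<Longrightarrow> anticommute (x + y) z" "anticommute x z \<Longrightarrow> anticommute y z \<Longrightarrow> anticommute (x - y) z"
  "anticommute z x \<Longrightarrow> anticommute z y \<Longrightarrow> anticommute z (x + y)" "anticommute z x \<Longrightarrow> anticommute z y \<Longrightarrow> anticommute z (x - y)"
  by (simp_all add: anticommute_def algebra_simps)

lemma car_anticommute:
  assumes "car N d d'" "i < N" "j < N"
  shows "anticommute (d i) (d j)" "anticommute (d' i) (d' j)" "i \<noteq> j \<Longrightarrow> anticommute (d i) (d' j)" "i \<noteq> j \<Longrightarrow> anticommute (d' i) (d j)"
proof -
  show "anticommute (d i) (d j)" "anticommute (d' i) (d' j)"
    using car_simps(1,2)[OF assms] by (simp_all only: anticommute_def)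
  show "anticommute (d i) (d' j)" if "i \<noteq> j"
    using car_simps(3)[OF assms] that by (simp only: anticommute_def) simp
  show "anticommute (d' i) (d j)" if "i \<noteq> j"
    using car_simps(3)[OF assms(1,3,2)] that by (simp only: anticommute_def) simp
qed

text \<open>The two factors anticommute and have squares -1 and 1, so the three signs
  cancel.\<close>

lemma flip_pair_square:
  assumes "car N d d'" "2 * k + 1 < N"
  defines "t \<equiv> flip_pair (d (2 * k)) (d' (2 * k)) (d (2 * k + 1)) (d' (2 * k + 1))"
  shows "t * t = 1"
proof -
  define x where "x = d' (2 * k) - d (2 * k)"
  define y where "y = d' (2 * k + 1) + d (2 * k + 1)"
  have "anticommute y x" unfolding x_def y_def
    by (intro anticommute_add car_anticommute[OF assms(1)]) (use assms(2) in auto)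
  moreover have "x * x = - 1" "y * y = 1"
    unfolding x_def y_def using assms(2) by (auto simp: algebra_simps car_simps(3,4,5)[OF assms(1)])
  moreover have "t * t = x * (y * x) * y"
    by (simp add: t_def flip_pair_def x_def y_def mult.assoc)
  ultimately show ?thesis by (simp add: anticommute_def mult.assoc)
qed

lemma flip_pair_commute:
  assumes "car N d d'" "2 * k + 1 < N" "j < N" "j \<noteq> 2 * k" "j \<noteq> 2 * k + 1"
  defines "t \<equiv> flip_pair (d (2 * k)) (d' (2 * k)) (d (2 * k + 1)) (d' (2 * k + 1))"
  shows "t * d j = d j * t" "t * d' j = d' j * t"
proof -
  have k: "2 * k < N" using assms(2) by simp
  have "2 * k \<noteq> j" "2 * k + 1 \<noteq> j" using assms(4,5) by auto
  note car = car_anticommute[OF assms(1) k assms(3)] car_anticommute[OF assms(1,2,3)]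
  show "t * d j = d j * t" "t * d' j = d' j * t"
    unfolding t_def flip_pair_def
    by (rule anticommute_commute_pair; rule anticommute_add; rule car; fact)+
qed

text \<open>Particle-hole exchange. With \<open>a = x' - x\<close> and \<open>b = y' + y\<close> one
  has \<open>a * x = - (x' * a)\<close> and \<open>b * y = y' * b\<close>; passing the other factor
  costs one more sign. Hence the plus sign on the even site and the minus sign on the odd
  one.\<close>

lemma flip_pair_swap:
  assumes "car N d d'" "2 * k + 1 < N"
  defines "t \<equiv> flip_pair (d (2 * k)) (d' (2 * k)) (d (2 * k + 1)) (d' (2 * k + 1))"
  shows "t * d (2 * k) = d' (2 * k) * t" "t * d' (2 * k) = d (2 * k) * t"
    "t * d (2 * k + 1) = - (d' (2 * k + 1) * t)" "t * d' (2 * k + 1) = - (d (2 * k + 1) * t)"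
proof -
  define x x' y y' where "x = d (2 * k)" and "x' = d' (2 * k)"
    and "y = d (2 * k + 1)" and "y' = d' (2 * k + 1)"
  have r: "y * x = - (x * y)" "y * x' = - (x' * y)" "y' * x = - (x * y')" "y' * x' = - (x' * y')"
    "x * x = 0" "x' * x' = 0" "y * y = 0" "y' * y' = 0" "x * x' = 1 - x' * x" "y * y' = 1 - y' * y"
    unfolding x_def x'_def y_def y'_def
    using assms(2) car_anticommute[OF assms(1), of "2 * k + 1" "2 * k"]
    by (auto simp: car_simps(3,4,5)[OF assms(1)] anticommute_def)
  \<comment> \<open>The relations \<open>r\<close> with an arbitrary tail \<open>z\<close>: together
    they rewrite right-associated words to a normal form with the first site before the second and
    creators before annihilators at each site.\<close>
  have r2: "y * (x * z) = - (x * (y * z))" "y * (x' * z) = - (x' * (y * z))"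
    "y' * (x * z) = - (x * (y' * z))" "y' * (x' * z) = - (x' * (y' * z))"
    "x * (x * z) = 0" "x' * (x' * z) = 0" "y * (y * z) = 0" "y' * (y' * z) = 0"
    "x * (x' * z) = z - x' * (x * z)" "y * (y' * z) = z - y' * (y * z)" for z
    by (simp_all add: r left_diff_distrib flip: mult.assoc)
  show "t * d (2 * k) = d' (2 * k) * t" "t * d' (2 * k) = d (2 * k) * t"
    "t * d (2 * k + 1) = - (d' (2 * k + 1) * t)" "t * d' (2 * k + 1) = - (d (2 * k + 1) * t)"
    unfolding t_def flip_pair_def x_def[symmetric] x'_def[symmetric] y_def[symmetric] y'_def[symmetric]
    by (simp_all add: algebra_simps r r2)
qed

text \<open>The sign depends on the parity of the site only. This is what makes complementation
  compatible with changes of modes that respect parity.\<close>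

lemma flip_all_swap:
  assumes "car (2 * n) d d'" "j < 2 * n"
  shows "flip_all n d d' * d j = (-1) ^ j * d' j * flip_all n d d'"
    "flip_all n d d' * d' j = (-1) ^ j * d j * flip_all n d d'"
proof -
  \<comment> \<open>The induction has to cover sites not yet reached by the first \<open>k\<close>
    pairs as well; with these the partial product commutes.\<close>
  have *: "flip_all k d d' * d j = (if j < 2 * k then (-1) ^ j * d' j else d j) * flip_all k d d' \<and>
      flip_all k d d' * d' j = (if j < 2 * k then (-1) ^ j * d j else d' j) * flip_all k d d'"
    if "k \<le> n" for k
    using that
  proof (induction k)
    case (Suc k)
    define t where "t = flip_pair (d (2 * k)) (d' (2 * k)) (d (2 * k + 1)) (d' (2 * k + 1))"
    have [simp]: "flip_all (Suc k) d d' = flip_all k d d' * t"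
      by (simp add: flip_all_def t_def)
    have k: "2 * k + 1 < 2 * n" using Suc by simp
    note IH = Suc.IH[OF Suc_leD[OF Suc.prems]]
    note swap = flip_pair_swap[OF assms(1) k, folded t_def]
    consider "j = 2 * k" | "j = 2 * k + 1" | "j \<noteq> 2 * k" "j \<noteq> 2 * k + 1" by auto
    then show ?case
    proof cases
      case 1
      then show ?thesis using IH swap by (auto simp: mult.assoc) (simp_all flip: mult.assoc)
    next
      case 2
      then show ?thesis using IH swap by (auto simp: mult.assoc) (simp_all flip: mult.assoc)
    next
      case 3
      have "t * d j = d j * t" "t * d' j = d' j * t"
        using flip_pair_commute[OF assms(1) k assms(2) 3] by (auto simp: t_def)
      then have "flip_all (Suc k) d d' * d j = flip_all k d d' * d j * t"
        "flip_all (Suc k) d d' * d' j = flip_all k d d' * d' j * t"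
        by (simp_all add: mult.assoc)
      then show ?thesis using IH 3 by (auto simp: mult.assoc)
    qed
  qed (simp add: flip_all_def)
  show "flip_all n d d' * d j = (-1) ^ j * d' j * flip_all n d d'"
    "flip_all n d d' * d' j = (-1) ^ j * d j * flip_all n d d'"
    using *[OF order_refl] assms(2) by auto
qed

lemma commute_mult:
  fixes x :: "'a::semigroup_mult"
  assumes "x * y = y * x" "x * z = z * x"
  shows "x * (y * z) = (y * z) * x"
proof -
  have "x * (y * z) = y * (x * z)" using assms(1) by (simp flip: mult.assoc)
  then show ?thesis by (simp add: assms(2) mult.assoc)
qed

lemma flip_pair_flip_pair_commute:
  assumes "car N d d'" "2 * k + 1 < N" "2 * l + 1 < N"
  shows "flip_pair (d (2 * k)) (d' (2 * k)) (d (2 * k + 1)) (d' (2 * k + 1)) *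
      flip_pair (d (2 * l)) (d' (2 * l)) (d (2 * l + 1)) (d' (2 * l + 1)) =
    flip_pair (d (2 * l)) (d' (2 * l)) (d (2 * l + 1)) (d' (2 * l + 1)) *
      flip_pair (d (2 * k)) (d' (2 * k)) (d (2 * k + 1)) (d' (2 * k + 1))" (is "?t * ?u = ?u * ?t")
proof (cases "k = l")
  case False
  have l: "2 * l \<noteq> 2 * k" "2 * l \<noteq> 2 * k + 1" "2 * l + 1 \<noteq> 2 * k" "2 * l + 1 \<noteq> 2 * k + 1"
    using False by presburger+
  have "?t * z = z * ?t" if "z \<in> {d (2 * l), d' (2 * l), d (2 * l + 1), d' (2 * l + 1)}" for z
    using that flip_pair_commute[OF assms(1,2), of "2 * l"] flip_pair_commute[OF assms(1,2), of "2 * l + 1"] l assms(3)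
    by auto
  then have "?t * (d' (2 * l) - d (2 * l)) = (d' (2 * l) - d (2 * l)) * ?t"
    "?t * (d' (2 * l + 1) + d (2 * l + 1)) = (d' (2 * l + 1) + d (2 * l + 1)) * ?t"
    by (simp_all add: algebra_simps)
  from commute_mult[OF this] show ?thesis
    by (simp only: flip_pair_def)
qed simp

lemma flip_all_square:
  assumes "car (2 * n) d d'"
  shows "flip_all n d d' * flip_all n d d' = 1"
proof -
  have "flip_all n d d' * flip_all n d d' = ordered_prod (\<lambda>k. 1) n"
    unfolding flip_all_def
  proof (subst ordered_prod_mult)
    show "ordered_prod (\<lambda>k. flip_pair (d (2 * k)) (d' (2 * k)) (d (2 * k + 1)) (d' (2 * k + 1)) *
        flip_pair (d (2 * k)) (d' (2 * k)) (d (2 * k + 1)) (d' (2 * k + 1))) n = ordered_prod (\<lambda>k. 1) n"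
    proof -
      have "m \<le> n \<Longrightarrow> ordered_prod (\<lambda>k. flip_pair (d (2 * k)) (d' (2 * k)) (d (2 * k + 1)) (d' (2 * k + 1)) *
        flip_pair (d (2 * k)) (d' (2 * k)) (d (2 * k + 1)) (d' (2 * k + 1))) m = ordered_prod (\<lambda>k. 1) m" for m
        using flip_pair_square[OF assms] by (induction m) auto
      then show ?thesis by simp
    qed
  qed (use flip_pair_flip_pair_commute[OF assms] in auto)
  also have "\<dots> = 1" by (induction n) auto
  finally show ?thesis .
qed

lemma app_flip_pair:
  "app (flip_pair (annihilate a) (create a) (annihilate (a + 1)) (create (a + 1))) f R = f ((R - {a, a + 1}) \<union> ({a, a + 1} - R))"
proof -
  have 1: "app (create a - annihilate a) g R = (if a \<in> R then jw_sign a R * g (R - {a}) else - (jw_sign a R * g (insert a R)))"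
    for g by (simp add: app_create app_annihilate flip: add_uminus_conv_diff)
  have 2: "app (create (a + 1) + annihilate (a + 1)) f Q =
      jw_sign (a + 1) Q * f (if a + 1 \<in> Q then Q - {a + 1} else insert (a + 1) Q)" for Q
    by (simp add: app_create app_annihilate)
  \<comment> \<open>The sign of the second factor is the opposite of that of the first exactly when
    \<open>a\<close> is occupied in \<open>Q\<close>, which is the case in which the first factor
    brings its minus sign.\<close>
  have 3: "jw_sign (a + 1) Q = (if a \<in> Q then - jw_sign a Q else jw_sign a Q)" for Q
    by (auto simp: jw_sign_def lessThan_Suc Int_insert_right)
  have 4: "jw_sign a (insert a R) = jw_sign a R" "jw_sign a (R - {a}) = jw_sign a R"
  proof -
    have "insert a R \<inter> {..<a} = R \<inter> {..<a}" "(R - {a}) \<inter> {..<a} = R \<inter> {..<a}" by auto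
    then show "jw_sign a (insert a R) = jw_sign a R" "jw_sign a (R - {a}) = jw_sign a R" by (simp_all add: jw_sign_def)
  qed
  have "app (flip_pair (annihilate a) (create a) (annihilate (a + 1)) (create (a + 1))) f R =
      app (create a - annihilate a) (app (create (a + 1) + annihilate (a + 1)) f) R"
    by (simp only: flip_pair_def app_mult)
  also have "\<dots> = f ((R - {a, a + 1}) \<union> ({a, a + 1} - R))"
    unfolding 1 2 3 4
    by (cases "a \<in> R"; cases "a + 1 \<in> R") (auto intro!: arg_cong[of _ _ f])
  finally show ?thesis .
qed

lemma app_flip_all:
  "app (flip_all n annihilate create) f R = f ((R - {..<2 * n}) \<union> ({..<2 * n} - R))"
proof (induction n arbitrary: f)
  case (Suc n)
  have "app (flip_all (Suc n) annihilate create) f R =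
      app (flip_all n annihilate create) (app (flip_pair (annihilate (2 * n)) (create (2 * n)) (annihilate (2 * n + 1)) (create (2 * n + 1))) f) R"
    by (simp add: flip_all_def)
  also have "\<dots> = f ((R - {..<2 * Suc n}) \<union> ({..<2 * Suc n} - R))"
    unfolding Suc.IH app_flip_pair
    by (rule arg_cong[of _ _ f]) (auto simp: less_Suc_eq)
  finally show ?case .
qed (simp add: flip_all_def)

section \<open>Dimer configurations on a path\<close>

definition dimer_cover :: "nat set \<Rightarrow> nat set" where
  "dimer_cover E = E \<union> Suc ` E"

text \<open>The number \<open>i\<close> stands for the dimer on the sites \<open>i\<close> and \<open>i + 1\<close>.\<close>

definition dimers :: "nat \<Rightarrow> nat set set" where
  "dimers m = {E. E \<subseteq> {..<m} \<and> (\<forall>i\<in>E. Suc i \<notin> E)}"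

lemma finite_dimers [simp]: "finite (dimers m)"
  by (rule finite_subset[of _ "Pow {..<m}"]) (auto simp: dimers_def)

text \<open>For \<open>E\<close> in \<open>dimers m\<close> the site \<open>m\<close> can only be
  covered by the dimer \<open>m - 1\<close>, so the side condition says that the dimer
  \<open>m\<close> may be added.\<close>

lemma dimers_Suc_split:
  "dimers (Suc m) = dimers m \<union> insert m ` {E \<in> dimers m. m \<notin> dimer_cover E}"
proof (intro equalityI subsetI)
  fix E assume E: "E \<in> dimers (Suc m)"
  show "E \<in> dimers m \<union> insert m ` {E \<in> dimers m. m \<notin> dimer_cover E}"
  proof (cases "m \<in> E")
    case True
    then have "E = insert m (E - {m})" by auto
    moreover have "E - {m} \<in> {E \<in> dimers m. m \<notin> dimer_cover E}"
      using E True by (auto simp: dimers_def dimer_cover_def lessThan_Suc)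
    ultimately show ?thesis by blast
  next
    case False
    then show ?thesis using E by (auto simp: dimers_def lessThan_Suc)
  qed
next
  fix E assume "E \<in> dimers m \<union> insert m ` {E \<in> dimers m. m \<notin> dimer_cover E}"
  then show "E \<in> dimers (Suc m)"
    by (auto simp: dimers_def dimer_cover_def lessThan_Suc)
qed

text \<open>Each factor either places its dimer or skips it, and overlapping dimers vanish. Every
  term has coefficient 1 because the signs of neighbouring creators cancel; this is why the
  fermionic product counts dimer configurations.\<close>

lemma app_chain:
  "app (ordered_prod (\<lambda>i. 1 + create i * create (Suc i)) m) f R = (\<Sum>E\<in>{E \<in> dimers m. dimer_cover E \<subseteq> R}. f (R - dimer_cover E))"
proof (induction m arbitrary: f)
  case 0
  have "{E \<in> dimers 0. dimer_cover E \<subseteq> R} = {{}}"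
    by (auto simp: dimers_def dimer_cover_def)
  then show ?case by (simp add: dimer_cover_def)
next
  case (Suc m)
  have pair: "app (create m * create (Suc m)) f Q = (if {m, Suc m} \<subseteq> Q then f (Q - {m, Suc m}) else 0)" for Q
  proof -
    \<comment> \<open>The second creator sees the set without \<open>m\<close>, hence the same
      occupied sites to its left as the first.\<close>
    have "jw_sign m Q * jw_sign (Suc m) (Q - {m}) = 1" if "m \<in> Q"
    proof -
      have "(Q - {m}) \<inter> {..<Suc m} = Q \<inter> {..<m}" by (auto simp: lessThan_Suc)
      then have "jw_sign (Suc m) (Q - {m}) = jw_sign m Q" by (simp add: jw_sign_def)
      then show ?thesis by simp
    qed
    moreover have "Q - {m} - {Suc m} = Q - {m, Suc m}" by auto
    ultimately show ?thesis
      by (auto simp: app_create simp flip: mult.assoc)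
  qed
  define A where "A = {E \<in> dimers m. dimer_cover E \<subseteq> R}"
  define B where "B = {E \<in> A. m \<notin> dimer_cover E \<and> {m, Suc m} \<subseteq> R}"
  have "{E \<in> dimers (Suc m). dimer_cover E \<subseteq> R} = A \<union> insert m ` B"
    unfolding dimers_Suc_split A_def B_def by (auto simp: dimer_cover_def)
  moreover have "A \<inter> insert m ` B = {}" "finite A" "finite B"
    unfolding A_def B_def dimers_def[of m] by (auto intro: finite_subset[of _ "Pow {..<m}"])
  ultimately have "(\<Sum>E\<in>{E \<in> dimers (Suc m). dimer_cover E \<subseteq> R}. f (R - dimer_cover E)) =
      (\<Sum>E\<in>A. f (R - dimer_cover E)) + (\<Sum>E\<in>insert m ` B. f (R - dimer_cover E))"
    by (simp add: sum.union_disjoint)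
  also have "(\<Sum>E\<in>insert m ` B. f (R - dimer_cover E)) = (\<Sum>E\<in>B. f (R - dimer_cover E - {m, Suc m}))"
  proof (subst sum.reindex)
    show "inj_on (insert m) B"
    proof (rule inj_onI)
      fix E F assume "E \<in> B" "F \<in> B" "insert m E = insert m F"
      moreover from this have "m \<notin> E" "m \<notin> F" by (auto simp: B_def dimer_cover_def)
      ultimately show "E = F" by (metis insert_ident)
    qed
    have "R - dimer_cover (insert m E) = R - dimer_cover E - {m, Suc m}" for E
      by (auto simp: dimer_cover_def)
    then show "sum ((\<lambda>E. f (R - dimer_cover E)) \<circ> insert m) B = (\<Sum>E\<in>B. f (R - dimer_cover E - {m, Suc m}))"
      by simp
  qed
  \<comment> \<open>Sets outside \<open>B\<close> contribute 0, and summing over \<open>A\<close>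
    gives the shape required by the induction hypothesis for the function transformed by the last
    factor.\<close>
  also have "\<dots> = (\<Sum>E\<in>A. app (create m * create (Suc m)) f (R - dimer_cover E))"
    unfolding pair
  proof (rule sum.mono_neutral_cong_left)
    have *: "Suc m \<notin> dimer_cover E" if "E \<in> A" for E
      using that by (auto simp: A_def dimers_def dimer_cover_def)
    show "\<forall>i\<in>A - B. (if {m, Suc m} \<subseteq> R - dimer_cover i then f (R - dimer_cover i - {m, Suc m}) else 0) = 0"
      by (auto simp: B_def)
    show "f (R - dimer_cover E - {m, Suc m}) =
        (if {m, Suc m} \<subseteq> R - dimer_cover E then f (R - dimer_cover E - {m, Suc m}) else 0)" if "E \<in> B" for E
      using that * by (auto simp: B_def)
  qed (use \<open>finite A\<close> in \<open>auto simp: B_def\<close>)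
  finally have sum: "(\<Sum>E\<in>{E \<in> dimers (Suc m). dimer_cover E \<subseteq> R}. f (R - dimer_cover E)) =
      (\<Sum>E\<in>A. f (R - dimer_cover E)) + (\<Sum>E\<in>A. app (create m * create (Suc m)) f (R - dimer_cover E))" .
  have "app (ordered_prod (\<lambda>i. 1 + create i * create (Suc i)) (Suc m)) f R =
      app (ordered_prod (\<lambda>i. 1 + create i * create (Suc i)) m) (\<lambda>S. f S + app (create m * create (Suc m)) f S) R"
  proof -
    have "app (1 + create m * create (Suc m)) f = (\<lambda>S. f S + app (create m * create (Suc m)) f S)"
      by (rule ext) simp
    then show ?thesis by simp
  qed
  also have "\<dots> = (\<Sum>E\<in>A. f (R - dimer_cover E) + app (create m * create (Suc m)) f (R - dimer_cover E))"
    unfolding Suc.IH A_def ..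
  finally show ?case
    unfolding sum by (simp only: sum.distrib)
qed

section \<open>Traces of ladder operators\<close>

text \<open>Moving \<open>w\<close> cyclically to the front and back through \<open>P\<close> and
  \<open>z\<close> reverses the sign of the trace.\<close>

lemma fock_trace_anticommute_pair:
  assumes "preserves H P" "preserves H z" "preserves H w" "P * w = w * P" "anticommute z w"
  shows "fock_trace H (P * (z * w)) = 0"
proof -
  have "fock_trace H (P * (z * w)) = fock_trace H (w * (P * z))"
    using fock_trace_cyclic[of H "P * z" w] assms by (simp add: mult.assoc)
  also have "w * (P * z) = - (P * (z * w))"
    using assms(4,5) by (simp add: anticommute_def flip: mult.assoc)
  finally show ?thesis by (simp add: fock_trace_uminus)
qed

text \<open>By cyclicity \<open>z * z'\<close> and \<open>z' * z\<close> have the same trace against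
  \<open>P\<close>, and they add up to 1.\<close>

lemma fock_trace_half:
  assumes "preserves H P" "preserves H z" "preserves H z'" "P * z' = z' * P" "z * z' = 1 - z' * z"
  shows "fock_trace H (P * (z * z')) = fock_trace H P / 2" "fock_trace H (P * (z' * z)) = fock_trace H P / 2"
proof -
  have "fock_trace H (P * (z * z')) = fock_trace H (z' * (P * z))"
    using fock_trace_cyclic[of H "P * z" z'] assms by (simp add: mult.assoc)
  also have "z' * (P * z) = P * (z' * z)"
    using assms(4) by (simp flip: mult.assoc)
  finally have *: "fock_trace H (P * (z * z')) = fock_trace H (P * (z' * z))" .
  moreover have "fock_trace H (P * (z * z')) = fock_trace H P - fock_trace H (P * (z' * z))"
    unfolding assms(5) by (simp add: algebra_simps fock_trace_diff)
  ultimately show "fock_trace H (P * (z * z')) = fock_trace H P / 2" "fock_trace H (P * (z' * z)) = fock_trace H P / 2"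
    by simp_all
qed

text \<open>If \<open>\<mu> = z - 1/z\<close>, then \<open>lucas \<mu> k = z^k + (-1/z)^k\<close>.\<close>

fun lucas :: "real \<Rightarrow> nat \<Rightarrow> real" where
  "lucas \<mu> 0 = 2"
| "lucas \<mu> (Suc 0) = \<mu>"
| "lucas \<mu> (Suc (Suc k)) = \<mu> * lucas \<mu> (Suc k) + lucas \<mu> k"

text \<open>The operator \<open>t\<close> splits into its parts \<open>u\<close> and \<open>v\<close> on the states with one, respectively zero or two, of the two
  sites occupied. There \<open>u\<close> is a transposition, while \<open>v\<close> satisfies the Lucas recurrence.\<close>

lemma fock_trace_ladder_power:
  fixes \<mu> :: real
  assumes car: "car N d d'" and k: "2 * k + 1 < N"
    and preserves: "preserves H P" "\<And>i. i < N \<Longrightarrow> preserves H (d i)" "\<And>i. i < N \<Longrightarrow> preserves H (d' i)"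
    and comm: "\<And>i. i \<in> {2 * k, 2 * k + 1} \<Longrightarrow> P * d i = d i * P"
      "\<And>i. i \<in> {2 * k, 2 * k + 1} \<Longrightarrow> P * d' i = d' i * P"
    and "odd L"
  defines "t \<equiv> flip_pair (d (2 * k)) (d' (2 * k)) (d (2 * k + 1)) (d' (2 * k + 1)) *
      (1 + \<mu> *\<^sub>R (d' (2 * k) * d' (2 * k + 1)))"
  shows "fock_trace H (P * t ^ L) = lucas \<mu> L / 4 * fock_trace H P"
proof -
  define x x' y y' where "x = d (2 * k)" and "x' = d' (2 * k)"
    and "y = d (2 * k + 1)" and "y' = d' (2 * k + 1)"
  note defs = x_def x'_def y_def y'_def
  have anticommute: "anticommute x y" "anticommute x y'" "anticommute x' y" "anticommute x' y'"
    "anticommute y x" "anticommute y x'" "anticommute y' x" "anticommute y' x'"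
    unfolding defs using k
    by (auto intro!: car_anticommute[OF car])
  have r: "y * x = - (x * y)" "y * x' = - (x' * y)" "y' * x = - (x * y')" "y' * x' = - (x' * y')"
    "x * x = 0" "x' * x' = 0" "y * y = 0" "y' * y' = 0" "x * x' = 1 - x' * x" "y * y' = 1 - y' * y"
    subgoal using anticommute by (simp add: anticommute_def)
    subgoal using anticommute by (simp add: anticommute_def)
    subgoal using anticommute by (simp add: anticommute_def)
    subgoal using anticommute by (simp add: anticommute_def)
    unfolding defs using k by (auto simp: car_simps(3,4,5)[OF car])
  have r2: "y * (x * z) = - (x * (y * z))" "y * (x' * z) = - (x' * (y * z))"
    "y' * (x * z) = - (x * (y' * z))" "y' * (x' * z) = - (x' * (y' * z))"
    "x * (x * z) = 0" "x' * (x' * z) = 0" "y * (y * z) = 0" "y' * (y' * z) = 0"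
    "x * (x' * z) = z - x' * (x * z)" "y * (y' * z) = z - y' * (y * z)" for z
    by (simp_all add: r left_diff_distrib flip: mult.assoc)
  define u where "u = x' * y - x * y'"
  \<comment> \<open>The projection onto the empty pair. It arises as
    \<open>- (x * y * x' * y')\<close>, the only term that survives when \<open>flip_pair\<close>
    meets the pair creator.\<close>
  define q where "q = x * x' * (y * y')"
  define v where "v = x' * y' - x * y + \<mu> *\<^sub>R q"
  have t: "t = u + v"
    unfolding t_def flip_pair_def defs[symmetric] u_def v_def q_def
    by (simp add: algebra_simps r r2)
  have uv: "u * v = 0" "v * u = 0"
    unfolding u_def v_def q_def by (simp_all add: algebra_simps r r2)
  have uuu: "u * u * u = u"
    unfolding u_def by (simp add: algebra_simps r r2)
  \<comment> \<open>The last summand is the projection onto the states with both sites empty or both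
    occupied. In this basis \<open>v\<close> is the matrix with rows (\<open>\<mu>\<close>, 1) and
    (1, 0).\<close>
  have vv: "v * v = \<mu> *\<^sub>R v + (q + x' * x * (y' * y))"
    unfolding v_def q_def by (simp add: algebra_simps r r2)
  have vp: "v * (q + x' * x * (y' * y)) = v"
    unfolding v_def q_def by (simp add: algebra_simps r r2)
  have vvv: "v * (v * v) = \<mu> *\<^sub>R (v * v) + v"
  proof -
    have "v * (v * v) = v * (\<mu> *\<^sub>R v + (q + x' * x * (y' * y)))" by (simp only: vv)
    also have "\<dots> = \<mu> *\<^sub>R (v * v) + v * (q + x' * x * (y' * y))"
      by (simp only: distrib_left mult_scaleR_right)
    finally show ?thesis unfolding vp .
  qed
  have l: "preserves H x" "preserves H x'" "preserves H y" "preserves H y'"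
    unfolding defs using preserves k by auto
  have c: "P * x = x * P" "P * x' = x' * P" "P * y = y * P" "P * y' = y' * P"
    unfolding defs using comm by auto
  have tu: "fock_trace H (P * u) = 0"
    unfolding u_def right_diff_distrib fock_trace_diff
    using fock_trace_anticommute_pair[of H P x' y] fock_trace_anticommute_pair[of H P x y'] l c preserves(1) anticommute by simp
  have pair: "P * (x * x') * y' = y' * (P * (x * x'))" "P * (x' * x) * y' = y' * (P * (x' * x))"
    using anticommute_commute_pair[of x y' x'] anticommute_commute_pair[of x' y' x] anticommute c(4)
    by (metis mult.assoc)+
  have tq: "fock_trace H (P * q) = fock_trace H P / 4"
    unfolding q_def using fock_trace_half(1)[of H "P * (x * x')" y y'] fock_trace_half(1)[of H P x x'] l c preserves(1) r pair
    by (simp add: mult.assoc)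
  have tp: "fock_trace H (P * (x' * x * (y' * y))) = fock_trace H P / 4"
    using fock_trace_half(2)[of H "P * (x' * x)" y y'] fock_trace_half(2)[of H P x x'] l c preserves(1) r pair
    by (simp add: mult.assoc)
  have tv: "fock_trace H (P * v) = \<mu> / 4 * fock_trace H P"
    using fock_trace_anticommute_pair[of H P x' y'] fock_trace_anticommute_pair[of H P x y] l c preserves(1) anticommute tq
    by (simp add: v_def algebra_simps fock_trace_add fock_trace_diff fock_trace_scaleR)
  have tvv: "fock_trace H (P * (v * v)) = (\<mu> * \<mu> + 2) / 4 * fock_trace H P"
    unfolding vv using tv tq tp
    by (simp add: distrib_left fock_trace_add fock_trace_scaleR) (simp add: field_simps)
  have tpow: "fock_trace H (P * v ^ Suc j) = lucas \<mu> (Suc j) / 4 * fock_trace H P" for j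
  proof (induction j rule: less_induct)
    case (less j)
    consider "j = 0" | "j = 1" | i where "j = Suc (Suc i)"
      by (metis One_nat_def not0_implies_Suc)
    then show ?case
    proof cases
      case 3
      have "v ^ Suc j = v ^ i * (v * (v * v))"
      proof -
        have "Suc j = i + 3" by (simp add: 3)
        then show ?thesis by (simp only: power_add power3_eq_cube mult.assoc)
      qed
      also have "\<dots> = \<mu> *\<^sub>R v ^ Suc (Suc i) + v ^ Suc i"
        unfolding vvv distrib_left mult_scaleR_right by (simp only: power_Suc2 mult.assoc)
      finally have "P * v ^ Suc j = \<mu> *\<^sub>R (P * v ^ Suc (Suc i)) + P * v ^ Suc i"
        by (simp add: distrib_left)
      with less[of "Suc i"] less[of i] show ?thesis
        by (simp add: 3 fock_trace_add fock_trace_scaleR algebra_simps del: power_Suc)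
    qed (use tv tvv in auto)
  qed
  have tL: "t ^ Suc j = u ^ Suc j + v ^ Suc j" for j
  proof (induction j)
    case (Suc j)
    have "t ^ Suc (Suc j) = (u + v) * (u ^ Suc j + v ^ Suc j)"
      unfolding Suc[symmetric] by (simp add: t)
    also have "\<dots> = u ^ Suc (Suc j) + v ^ Suc (Suc j) + u * v * v ^ j + v * u * u ^ j"
      by (simp add: algebra_simps)
    finally show ?case by (simp add: uv)
  qed (simp add: t)
  obtain j where j: "L = Suc (2 * j)"
    using \<open>odd L\<close> by (auto elim: oddE)
  \<comment> \<open>Odd powers of \<open>u\<close> reduce to \<open>u\<close>, which is traceless
    against \<open>P\<close>; here the parity of \<open>L\<close> enters.\<close>
  have "u ^ Suc (2 * j) = u"
  proof (induction j)
    case (Suc j)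
    have "u ^ Suc (2 * Suc j) = u * u * u ^ Suc (2 * j)" by (simp add: mult.assoc)
    with Suc uuu show ?case by simp
  qed simp
  then show ?thesis
    unfolding j tL distrib_left fock_trace_add tpow by (simp add: tu)
qed

text \<open>The ladders commute, so the power distributes over them. Each ladder is peeled off the
  trace with a quarter of its Lucas value, and the quarters are repaid by the dimension
  \<open>4 ^ n\<close>.\<close>

lemma fock_trace_ladders_power:
  assumes car: "car (2 * n) d d'" and "odd L"
    and preserves: "\<And>i. i < 2 * n \<Longrightarrow> preserves (2 * n) (d i)" "\<And>i. i < 2 * n \<Longrightarrow> preserves (2 * n) (d' i)"
  shows "fock_trace (2 * n) ((flip_all n d d' *
      ordered_prod (\<lambda>k. 1 + \<mu> k *\<^sub>R (d' (2 * k) * d' (2 * k + 1))) n) ^ L) = (\<Prod>k<n. lucas (\<mu> k) L)"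
proof -
  define \<tau> where "\<tau> k = flip_pair (d (2 * k)) (d' (2 * k)) (d (2 * k + 1)) (d' (2 * k + 1))" for k
  define w where "w k = 1 + \<mu> k *\<^sub>R (d' (2 * k) * d' (2 * k + 1))" for k
  have \<tau>d: "\<tau> k * d j = d j * \<tau> k" "\<tau> k * d' j = d' j * \<tau> k"
    if "k < n" "j < 2 * n" "j \<noteq> 2 * k" "j \<noteq> 2 * k + 1" for k j
    using flip_pair_commute[OF car _ that(2-4)] that(1) by (auto simp: \<tau>_def)
  have dd: "d' (2 * k) * d' (2 * k + 1) * d j = d j * (d' (2 * k) * d' (2 * k + 1))"
    "d' (2 * k) * d' (2 * k + 1) * d' j = d' j * (d' (2 * k) * d' (2 * k + 1))"
    if "k < n" "j < 2 * n" "j \<noteq> 2 * k" "j \<noteq> 2 * k + 1" for k j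
    by (rule anticommute_commute_pair; rule car_anticommute[OF car]; use that in simp)+
  have wd: "w k * d j = d j * w k" "w k * d' j = d' j * w k"
    if "k < n" "j < 2 * n" "j \<noteq> 2 * k" "j \<noteq> 2 * k + 1" for k j
    unfolding w_def using dd[OF that] by (simp_all add: distrib_left distrib_right)
  have neq: "2 * j \<noteq> 2 * k" "2 * j \<noteq> 2 * k + 1" "2 * j + 1 \<noteq> 2 * k" "2 * j + 1 \<noteq> 2 * k + 1"
    if "j \<noteq> k" for j k :: nat using that by presburger+
  have \<tau>w: "\<tau> i * w j = w j * \<tau> i" if "i < n" "j < n" "i \<noteq> j" for i j
  proof -
    have "\<tau> i * (d' (2 * j) * d' (2 * j + 1)) = d' (2 * j) * d' (2 * j + 1) * \<tau> i"
      by (intro commute_mult \<tau>d) (use that neq[of j i] in auto)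
    then show ?thesis by (simp add: w_def distrib_left distrib_right)
  qed
  have \<tau>\<tau>: "\<tau> i * \<tau> j = \<tau> j * \<tau> i" if "i < n" "j < n" for i j
    unfolding \<tau>_def using that by (intro flip_pair_flip_pair_commute[OF car]) auto
  have ww: "w i * w j = w j * w i" if "i < n" "j < n" for i j
  proof (cases "i = j")
    case False
    then have "w i * (d' (2 * j) * d' (2 * j + 1)) = d' (2 * j) * d' (2 * j + 1) * w i"
      by (intro commute_mult wd) (use that neq[of j i] in auto)
    then show ?thesis by (subst (2 3) w_def) (simp add: distrib_left distrib_right)
  qed simp
  define t where "t k = \<tau> k * w k" for k
  have tt: "t i * t j = t j * t i" if "i < n" "j < n" for i j
  proof (cases "i = j")
    case False
    then have "\<tau> i * t j = t j * \<tau> i" "w i * t j = t j * w i"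
      unfolding t_def using that \<tau>\<tau> \<tau>w ww by (metis commute_mult)+
    then show ?thesis
      using commute_mult[of "t j" "\<tau> i" "w i"] by (simp add: t_def)
  qed simp
  have "(flip_all n d d' * ordered_prod w n) ^ L = ordered_prod (\<lambda>k. t k ^ L) n"
    unfolding flip_all_def \<tau>_def[symmetric] t_def[symmetric] using \<tau>w tt
    by (subst ordered_prod_mult) (auto simp: ordered_prod_power simp flip: t_def)
  \<comment> \<open>The trace is over all \<open>2 * n\<close> sites for every \<open>m\<close>,
    hence \<open>4 ^ n\<close> and not \<open>4 ^ m\<close>.\<close>
  moreover have "fock_trace (2 * n) (ordered_prod (\<lambda>k. t k ^ L) m) = (\<Prod>k<m. lucas (\<mu> k) L / 4) * 4 ^ n" if "m \<le> n" for m
    using that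
  proof (induction m)
    case 0
    show ?case by (simp add: fock_trace_one power_mult)
  next
    case (Suc m)
    have t_preserves: "preserves (2 * n) (t k)" if "k < n" for k
      unfolding t_def \<tau>_def w_def flip_pair_def using preserves that by auto
    define P where "P = ordered_prod (\<lambda>k. t k ^ L) m"
    have comm: "P * z = z * P" if "z \<in> {d (2 * m), d' (2 * m), d (2 * m + 1), d' (2 * m + 1)}" for z
      unfolding P_def
    proof (rule ordered_prod_commute)
      fix i assume i: "i < m"
      then have "m \<noteq> i" "i < n" "2 * m + 1 < 2 * n" using Suc.prems by auto
      then have "\<tau> i * z = z * \<tau> i" "w i * z = z * w i"
        using that neq[OF \<open>m \<noteq> i\<close>] \<tau>d[of i "2 * m"] \<tau>d[of i "2 * m + 1"] wd[of i "2 * m"] wd[of i "2 * m + 1"]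
        by auto
      then have "z * t i = t i * z"
        unfolding t_def by (metis commute_mult)
      then show "t i ^ L * z = z * t i ^ L"
        by (metis power_commuting_commutes)
    qed
    have "fock_trace (2 * n) (P * t m ^ L) = lucas (\<mu> m) L / 4 * fock_trace (2 * n) P"
      unfolding t_def \<tau>_def w_def
    proof (rule fock_trace_ladder_power[OF car])
      show "preserves (2 * n) P"
        unfolding P_def using Suc.prems t_preserves by auto
    qed (use Suc.prems preserves comm \<open>odd L\<close> in auto)
    then show ?case
      using Suc by (simp add: P_def)
  qed
  ultimately have "fock_trace (2 * n) ((flip_all n d d' * ordered_prod w n) ^ L) = (\<Prod>k<n. lucas (\<mu> k) L / 4) * 4 ^ n"
    by simp
  also have "\<dots> = (\<Prod>k<n. lucas (\<mu> k) L)"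
    by (simp add: prod_dividef)
  finally show ?thesis by (simp add: w_def[abs_def])
qed

section \<open>Orthogonal changes of modes\<close>

definition mode :: "(nat \<Rightarrow> nat \<Rightarrow> real) \<Rightarrow> nat \<Rightarrow> (nat \<Rightarrow> 'a::real_vector) \<Rightarrow> nat \<Rightarrow> 'a" where
  "mode U N d j = (\<Sum>i<N. U j i *\<^sub>R d i)"

lemma mode_mult:
  fixes d e :: "nat \<Rightarrow> 'a::real_algebra_1"
  shows "mode U N d i * mode U N e j = (\<Sum>a<N. \<Sum>b<N. (U i a * U j b) *\<^sub>R (d a * e b))"
  by (simp add: mode_def sum_product mult.commute)

lemma mode_mult_swap:
  fixes d e :: "nat \<Rightarrow> 'a::real_algebra_1"
  shows "mode U N e j * mode U N d i = (\<Sum>a<N. \<Sum>b<N. (U i a * U j b) *\<^sub>R (e b * d a))"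
  unfolding mode_mult by (subst sum.swap) (simp add: mult.commute)

lemma car_mode:
  assumes car: "car N d d'"
    and row: "\<And>i j. i < N \<Longrightarrow> j < N \<Longrightarrow> (\<Sum>k<N. U i k * U j k) = of_bool (i = j)"
  shows "car N (mode U N d) (mode U N d')"
  unfolding car_def
proof (intro allI impI conjI)
  fix i j assume ij: "i < N" "j < N"
  show "mode U N d i * mode U N d j = - (mode U N d j * mode U N d i)"
    unfolding mode_mult[of U N d i d j] mode_mult_swap[of U N d j d i] sum_negf[symmetric] scaleR_minus_right[symmetric]
    by (intro sum.cong refl arg_cong2[of _ _ _ _ scaleR] car_simps(1)[OF car]) auto
  show "mode U N d' i * mode U N d' j = - (mode U N d' j * mode U N d' i)"
    unfolding mode_mult[of U N d' i d' j] mode_mult_swap[of U N d' j d' i] sum_negf[symmetric] scaleR_minus_right[symmetric]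
    by (intro sum.cong refl arg_cong2[of _ _ _ _ scaleR] car_simps(2)[OF car]) auto
  have "mode U N d i * mode U N d' j =
      (\<Sum>a<N. \<Sum>b<N. (U i a * U j b) *\<^sub>R (of_bool (a = b) - d' b * d a))"
    unfolding mode_mult
    by (intro sum.cong refl arg_cong2[of _ _ _ _ scaleR] car_simps(3)[OF car]) auto
  also have "\<dots> = (\<Sum>a<N. \<Sum>b<N. (U i a * U j b) *\<^sub>R of_bool (a = b)) - mode U N d' j * mode U N d i"
    unfolding mode_mult_swap by (simp add: scaleR_diff_right sum_subtractf)
  also have "(\<Sum>a<N. \<Sum>b<N. (U i a * U j b) *\<^sub>R of_bool (a = b)) = (\<Sum>a<N. U i a * U j a) *\<^sub>R (1::'a)"
    unfolding scaleR_left.sum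
  proof (rule sum.cong[OF refl])
    fix a assume "a \<in> {..<N}"
    have "(\<Sum>b<N. (U i a * U j b) *\<^sub>R of_bool (a = b)) = (\<Sum>b<N. if a = b then (U i a * U j a) *\<^sub>R (1::'a) else 0)"
      by (intro sum.cong) auto
    also have "\<dots> = (U i a * U j a) *\<^sub>R 1"
      using \<open>a \<in> {..<N}\<close> by simp
    finally show "(\<Sum>b<N. (U i a * U j b) *\<^sub>R of_bool (a = b)) = (U i a * U j a) *\<^sub>R (1::'a)" .
  qed
  finally show "mode U N d i * mode U N d' j = of_bool (i = j) - mode U N d' j * mode U N d i"
    by (simp add: row ij)
qed

lemma mode_inverse:
  assumes col: "\<And>i j. i < N \<Longrightarrow> j < N \<Longrightarrow> (\<Sum>k<N. U k i * U k j) = of_bool (i = j)" and "i < N"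
  shows "d i = (\<Sum>j<N. U j i *\<^sub>R mode U N d j)"
proof -
  have "(\<Sum>j<N. U j i *\<^sub>R mode U N d j) = (\<Sum>k<N. \<Sum>j<N. (U j i * U j k) *\<^sub>R d k)"
    unfolding mode_def by (subst sum.swap) (simp add: scaleR_sum_right)
  also have "\<dots> = (\<Sum>k<N. of_bool (i = k) *\<^sub>R d k)"
    by (intro sum.cong refl) (use assms in \<open>simp flip: scaleR_left.sum\<close>)
  also have "\<dots> = (\<Sum>k<N. if i = k then d i else 0)"
    by (intro sum.cong) auto
  also have "\<dots> = d i" using assms(2) by simp
  finally show ?thesis ..
qed

text \<open>The sign \<open>(-1) ^ i\<close> produced at site \<open>i\<close> is constant over the
  sites that occur in mode \<open>j\<close>, so it can be pulled out of the sum.\<close>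

lemma flip_all_mode_swap:
  assumes car: "car (2 * n) d d'"
    and par: "\<And>i j. even i \<noteq> even j \<Longrightarrow> U i j = 0"
  shows "flip_all n d d' * mode U (2 * n) d j = (-1) ^ j * mode U (2 * n) d' j * flip_all n d d'"
    "flip_all n d d' * mode U (2 * n) d' j = (-1) ^ j * mode U (2 * n) d j * flip_all n d d'"
proof -
  have *: "U j i *\<^sub>R ((-1) ^ i * z) = (-1) ^ j * (U j i *\<^sub>R z)" for i and z :: 'a
    using par[of j i] by (cases "even i"; cases "even j") auto
  have "flip_all n d d' * mode U (2 * n) d j = (\<Sum>i<2*n. U j i *\<^sub>R (flip_all n d d' * d i))"
    by (simp add: mode_def sum_distrib_left)
  also have "\<dots> = (\<Sum>i<2*n. (-1) ^ j * (U j i *\<^sub>R d' i) * flip_all n d d')"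
    by (intro sum.cong refl) (simp add: flip_all_swap(1)[OF car] * mult.assoc)
  also have "\<dots> = (-1) ^ j * mode U (2 * n) d' j * flip_all n d d'"
    by (simp add: mode_def sum_distrib_left sum_distrib_right)
  finally show "flip_all n d d' * mode U (2 * n) d j = (-1) ^ j * mode U (2 * n) d' j * flip_all n d d'" .
  have "flip_all n d d' * mode U (2 * n) d' j = (\<Sum>i<2*n. U j i *\<^sub>R (flip_all n d d' * d' i))"
    by (simp add: mode_def sum_distrib_left)
  also have "\<dots> = (\<Sum>i<2*n. (-1) ^ j * (U j i *\<^sub>R d i) * flip_all n d d')"
    by (intro sum.cong refl) (simp add: flip_all_swap(2)[OF car] * mult.assoc)
  also have "\<dots> = (-1) ^ j * mode U (2 * n) d j * flip_all n d d'"
    by (simp add: mode_def sum_distrib_left sum_distrib_right)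
  finally show "flip_all n d d' * mode U (2 * n) d' j = (-1) ^ j * mode U (2 * n) d j * flip_all n d d'" .
qed

lemma preserves_flip_all:
  assumes "\<And>i. i < 2 * n \<Longrightarrow> preserves H (d i)" "\<And>i. i < 2 * n \<Longrightarrow> preserves H (d' i)"
  shows "preserves H (flip_all n d d')"
  unfolding flip_all_def flip_pair_def using assms by (intro preserves_ordered_prod preserves_mult preserves_diff preserves_add) auto

lemma preserves_mode [simp, intro]: "(\<And>i. i < N \<Longrightarrow> preserves H (d i)) \<Longrightarrow> preserves H (mode U N d j)"
  unfolding mode_def by auto

text \<open>The product of the two complementations commutes with all modes, so it is a scalar, and both are involutions.\<close>

lemma flip_all_mode:
  fixes U :: "nat \<Rightarrow> nat \<Rightarrow> real" and n :: nat
  assumes row: "\<And>i j. i < 2 * n \<Longrightarrow> j < 2 * n \<Longrightarrow> (\<Sum>k<2*n. U i k * U j k) = of_bool (i = j)"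
    and col: "\<And>i j. i < 2 * n \<Longrightarrow> j < 2 * n \<Longrightarrow> (\<Sum>k<2*n. U k i * U k j) = of_bool (i = j)"
    and par: "\<And>i j. even i \<noteq> even j \<Longrightarrow> U i j = 0"
  shows "\<exists>s. s * s = 1 \<and> (\<forall>f. supported (2 * n) f \<longrightarrow>
      app (flip_all n annihilate create) f = (\<lambda>S. s * app (flip_all n (mode U (2 * n) annihilate) (mode U (2 * n) create)) f S))"
proof -
  define C where "C = flip_all n annihilate create"
  define D where "D = mode U (2 * n) annihilate"
  define D' where "D' = mode U (2 * n) create"
  define C' where "C' = flip_all n D D'"
  have carD: "car (2 * n) D D'"
    unfolding D_def D'_def by (intro car_mode car_annihilate_create row)
  have CC: "C * C = 1" "C' * C' = 1"
    unfolding C_def C'_def using flip_all_square car_annihilate_create carD by auto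
  \<comment> \<open>Each complementation contributes the sign \<open>(-1) ^ j\<close>, and the two
    signs cancel.\<close>
  have comm: "C' * C * D j = D j * (C' * C)" "C' * C * D' j = D' j * (C' * C)" if "j < 2 * n" for j
  proof -
    have e: "C' * ((-1) ^ j * z) = (-1) ^ j * (C' * z)" "(-1) ^ j * ((-1) ^ j * z) = z" for z :: fock_op
      by (cases "even j"; simp)+
    have 1: "C * D j = (-1) ^ j * D' j * C" "C * D' j = (-1) ^ j * D j * C"
      unfolding C_def D_def D'_def using flip_all_mode_swap[of n annihilate create U j, OF car_annihilate_create par] by auto
    have 2: "C' * D j = (-1) ^ j * D' j * C'" "C' * D' j = (-1) ^ j * D j * C'"
      unfolding C'_def using flip_all_swap[OF carD that] by auto
    have "C' * C * D j = C' * ((-1) ^ j * D' j * C)" unfolding 1[symmetric] by (simp add: mult.assoc)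
    also have "\<dots> = (-1) ^ j * (C' * D' j * C)" by (simp add: mult.assoc e)
    finally show "C' * C * D j = D j * (C' * C)" unfolding 2 by (simp add: mult.assoc e)
    have "C' * C * D' j = C' * ((-1) ^ j * D j * C)" unfolding 1[symmetric] by (simp add: mult.assoc)
    also have "\<dots> = (-1) ^ j * (C' * D j * C)" by (simp add: mult.assoc e)
    finally show "C' * C * D' j = D' j * (C' * C)" unfolding 2 by (simp add: mult.assoc e)
  qed
  have locs: "preserves (2 * n) C" "preserves (2 * n) C'"
    unfolding C_def C'_def D_def D'_def by (intro preserves_flip_all; auto)+
  have "\<exists>s. \<forall>f. supported (2 * n) f \<longrightarrow> app (C' * C) f = (\<lambda>S. s * f S)"
  proof (rule schur[of "2 * n" "C' * C"])
    show "preserves (2 * n) (C' * C)" using locs by auto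
    show "C' * C * annihilate i = annihilate i * (C' * C)" if "i < 2 * n" for i
    proof -
      \<comment> \<open>Schur's lemma asks for the original sites, which the orthonormal columns of
        \<open>U\<close> recover from the modes.\<close>
      have "annihilate i = (\<Sum>j<2*n. U j i *\<^sub>R D j)"
        unfolding D_def by (intro mode_inverse col that)
      then show ?thesis by (simp add: sum_distrib_left sum_distrib_right comm)
    qed
    show "C' * C * create i = create i * (C' * C)" if "i < 2 * n" for i
    proof -
      have "create i = (\<Sum>j<2*n. U j i *\<^sub>R D' j)"
        unfolding D'_def by (intro mode_inverse col that)
      then show ?thesis by (simp add: sum_distrib_left sum_distrib_right comm)
    qed
  qed blast
  then obtain s where s: "\<And>f. supported (2 * n) f \<Longrightarrow> app (C' * C) f = (\<lambda>S. s * f S)"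
    by blast
  have C: "app C f = (\<lambda>S. s * app C' f S)" if "supported (2 * n) f" for f
  proof -
    have "app C f = app (C' * C' * C) f" by (simp add: CC)
    also have "\<dots> = app C' (app (C' * C) f)" by simp
    finally show ?thesis unfolding s[OF that] app_arg_scale .
  qed
  have "s * s = 1"
  proof -
    have "point_fn {} = app C (app C (point_fn {}))"
      unfolding app_mult[symmetric] CC by simp
    also have "\<dots> = (\<lambda>S. s * (s * app C' (app C' (point_fn {})) S))"
      using locs by (simp add: C supported_point_fn preserves_def app_arg_scale)
    also have "\<dots> = (\<lambda>S. s * s * point_fn {} S)"
      unfolding app_mult[symmetric] CC by (simp add: mult.assoc)
    finally have "point_fn {} {} = s * s * point_fn {} {}" by metis
    then show ?thesis by (simp add: point_fn_def)
  qed
  with C show ?thesis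
    by (intro exI[of _ s]) (auto simp: C_def C'_def D_def D'_def)
qed

text \<open>The operator \<open>V\<close> of the overview. The argument counts bonds, so
  \<open>2 * n\<close> sites use \<open>2 * n - 1\<close>; for \<open>n = 0\<close> truncated
  subtraction yields the empty product.\<close>

definition chain :: "nat \<Rightarrow> fock_op" where
  "chain m = ordered_prod (\<lambda>i. 1 + create i * create (Suc i)) m"

lemma preserves_chain: "m < H \<or> m = 0 \<Longrightarrow> preserves H (chain m)"
  unfolding chain_def by (intro preserves_ordered_prod preserves_add preserves_mult preserves_create preserves_one) auto

lemma sum_odd_even:
  fixes g :: "nat \<Rightarrow> 'a::comm_monoid_add"
  shows "(\<Sum>i<2*n. g i) = (\<Sum>l<n. g (2 * l) + g (2 * l + 1))"
  by (induction n) (simp_all add: add.assoc)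

lemma mode_parity:
  assumes par: "\<And>i j. even i \<noteq> even j \<Longrightarrow> U i j = 0"
  shows "mode U (2 * n) d (2 * k) = (\<Sum>l<n. U (2 * k) (2 * l) *\<^sub>R d (2 * l))"
    "mode U (2 * n) d (2 * k + 1) = (\<Sum>l<n. U (2 * k + 1) (2 * l + 1) *\<^sub>R d (2 * l + 1))"
  unfolding mode_def sum_odd_even using par[of "2 * k" "2 * _ + 1"] par[of "2 * k + 1" "2 * _"]
  by simp_all

lemma anticommute_pair_square:
  assumes "anticommute x y" "x * x = 0" shows "(x * y) * (x * y) = 0"
proof -
  have "y * x = - (x * y)" using assms(1) by (simp add: anticommute_def)
  moreover have "(x * y) * (x * y) = x * (y * x) * y" by (simp add: mult.assoc)
  ultimately have "(x * y) * (x * y) = - (x * x * (y * y))" by (simp add: mult.assoc)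
  then show ?thesis using assms(2) by simp
qed

lemma car_pair_commute:
  assumes car: "car N d d'" and "a < N" "b < N" "a' < N" "b' < N"
  shows "(d' a * d' b) * (d' a' * d' b') = (d' a' * d' b') * (d' a * d' b)"
  by (intro commute_mult anticommute_commute_pair car_anticommute[OF car] assms)

lemma car_pair_square:
  assumes car: "car N d d'" and "a < N" "b < N"
  shows "(d' a * d' b) * (d' a * d' b) = 0"
  by (intro anticommute_pair_square car_anticommute(2)[OF car] car_simps(5)[OF car assms(2,2)] assms)

text \<open>The two products have the same exponent: \<open>sing\<close> is a singular value
  decomposition of the signed adjacency matrix between even sites \<open>2 * l\<close> and odd sites
  \<open>2 * m + 1\<close>.\<close>

lemma chain_mode:
  fixes U :: "nat \<Rightarrow> nat \<Rightarrow> real" and n :: nat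
  assumes row: "\<And>i j. i < 2 * n \<Longrightarrow> j < 2 * n \<Longrightarrow> (\<Sum>k<2*n. U i k * U j k) = of_bool (i = j)"
    and par: "\<And>i j. even i \<noteq> even j \<Longrightarrow> U i j = 0"
    and sing: "\<And>l m. l < n \<Longrightarrow> m < n \<Longrightarrow>
      (\<Sum>k<n. \<mu> k * (U (2 * k) (2 * l) * U (2 * k + 1) (2 * m + 1))) = of_bool (l = m) - of_bool (l = Suc m)"
  shows "chain (2 * n - 1) =
    ordered_prod (\<lambda>k. 1 + \<mu> k *\<^sub>R (mode U (2 * n) create (2 * k) * mode U (2 * n) create (2 * k + 1))) n"
  unfolding chain_def
proof (rule ordered_prod_one_plus_cong)
  define D where "D = mode U (2 * n) annihilate"
  define D' where "D' = mode U (2 * n) create"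
  have car: "car (2 * n) D D'"
    unfolding D_def D'_def by (intro car_mode car_annihilate_create row)
  show "create i * create (Suc i) * (create j * create (Suc j)) = create j * create (Suc j) * (create i * create (Suc i))" for i j
    by (rule car_pair_commute[OF car_annihilate_create[of "Suc (Suc (i + j))"]]) auto
  show "create i * create (Suc i) * (create i * create (Suc i)) = 0" for i
    by (rule car_pair_square[OF car_annihilate_create[of "Suc (Suc i)"]]) auto
  have "D' (2 * i) * D' (2 * i + 1) * (D' (2 * j) * D' (2 * j + 1)) =
      D' (2 * j) * D' (2 * j + 1) * (D' (2 * i) * D' (2 * i + 1))"
    "D' (2 * i) * D' (2 * i + 1) * (D' (2 * i) * D' (2 * i + 1)) = 0"
    if "i < n" "j < n" for i j
    by (rule car_pair_commute[OF car] car_pair_square[OF car]; use that in simp)+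
  then show "\<mu> i *\<^sub>R (D' (2 * i) * D' (2 * i + 1)) * \<mu> j *\<^sub>R (D' (2 * j) * D' (2 * j + 1)) =
      \<mu> j *\<^sub>R (D' (2 * j) * D' (2 * j + 1)) * \<mu> i *\<^sub>R (D' (2 * i) * D' (2 * i + 1))"
    "\<mu> i *\<^sub>R (D' (2 * i) * D' (2 * i + 1)) * \<mu> i *\<^sub>R (D' (2 * i) * D' (2 * i + 1)) = 0"
    if "i < n" "j < n" for i j
    using that by (simp_all add: mult.commute[of "\<mu> i" "\<mu> j"])
  have "(\<Sum>k<n. \<mu> k *\<^sub>R (D' (2 * k) * D' (2 * k + 1))) =
      (\<Sum>k<n. \<Sum>l<n. \<Sum>m<n. (\<mu> k * (U (2 * k) (2 * l) * U (2 * k + 1) (2 * m + 1))) *\<^sub>R (create (2 * l) * create (2 * m + 1)))"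
  proof -
    have "D' (2 * k) * D' (2 * k + 1) =
        (\<Sum>l<n. \<Sum>m<n. (U (2 * k) (2 * l) * U (2 * k + 1) (2 * m + 1)) *\<^sub>R (create (2 * l) * create (2 * m + 1)))" for k
      unfolding D'_def using mode_parity[of U n create k] par
      by (simp add: sum_product mult.commute del: One_nat_def)
    then show ?thesis by (simp add: scaleR_sum_right)
  qed
  also have "\<dots> = (\<Sum>l<n. \<Sum>m<n. \<Sum>k<n. (\<mu> k * (U (2 * k) (2 * l) * U (2 * k + 1) (2 * m + 1))) *\<^sub>R (create (2 * l) * create (2 * m + 1)))"
    by (subst sum.swap, rule sum.cong[OF refl], subst sum.swap, rule refl)
  also have "\<dots> = (\<Sum>l<n. \<Sum>m<n. (of_bool (l = m) - of_bool (l = Suc m)) *\<^sub>R (create (2 * l) * create (2 * m + 1)))"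
    by (intro sum.cong refl) (simp only: scaleR_left.sum[symmetric] sing lessThan_iff)
  also have "\<dots> = (\<Sum>l<n. create (2 * l) * create (2 * l + 1)) - (\<Sum>m<n. \<Sum>l<n. of_bool (l = Suc m) *\<^sub>R (create (2 * l) * create (2 * m + 1)))"
  proof -
    have "(\<Sum>m<n. of_bool (l = m) *\<^sub>R (create (2 * l) * create (2 * m + 1))) = create (2 * l) * create (2 * l + 1)" if "l < n" for l
    proof -
      have "(\<Sum>m<n. of_bool (l = m) *\<^sub>R (create (2 * l) * create (2 * m + 1))) = (\<Sum>m<n. if l = m then create (2 * l) * create (2 * l + 1) else 0)"
        by (intro sum.cong) auto
      with that show ?thesis by simp
    qed
    then show ?thesis
      by (subst (2) sum.swap) (simp add: scaleR_diff_left sum_subtractf)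
  qed
  also have "(\<Sum>m<n. \<Sum>l<n. of_bool (l = Suc m) *\<^sub>R (create (2 * l) * create (2 * m + 1))) =
      (\<Sum>m<n. if Suc m < n then create (2 * m + 2) * create (2 * m + 1) else 0)"
  proof (intro sum.cong refl)
    fix m
    have "(\<Sum>l<n. of_bool (l = Suc m) *\<^sub>R (create (2 * l) * create (2 * m + 1))) =
        (\<Sum>l<n. if l = Suc m then create (2 * m + 2) * create (2 * m + 1) else 0)"
      by (intro sum.cong) auto
    then show "(\<Sum>l<n. of_bool (l = Suc m) *\<^sub>R (create (2 * l) * create (2 * m + 1))) =
        (if Suc m < n then create (2 * m + 2) * create (2 * m + 1) else 0)"
      by simp
  qed
  also have "\<dots> = - (\<Sum>m<n-1. create (2 * m + 1) * create (2 * m + 2))"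
  proof -
    \<comment> \<open>This bond has its odd site first. Putting the even site first reverses the
      sign, which is the origin of the minus in \<open>sing\<close>.\<close>
    have "create (2 * m + 2) * create (2 * m + 1) = - (create (2 * m + 1) * create (2 * m + 2))" for m
      by (rule car_simps(2)[OF car_annihilate_create[of "2 * m + 3"]]) auto
    moreover have "(\<Sum>m<n. if Suc m < n then g m else 0) = (\<Sum>m<n-1. g m)" for g :: "nat \<Rightarrow> fock_op"
      by (rule sum.mono_neutral_cong_right) auto
    ultimately show ?thesis
      by (simp only: sum_negf)
  qed
  also have "(\<Sum>l<n. create (2 * l) * create (2 * l + 1)) - - (\<Sum>m<n-1. create (2 * m + 1) * create (2 * m + 2)) =
      (\<Sum>i<2*n-1. create i * create (Suc i))"
  proof (cases n)
    case (Suc k)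
    then show ?thesis
      by (simp add: sum_odd_even[of "\<lambda>i. create i * create (Suc i)" k] sum.distrib add_ac)
  qed simp
  finally show "(\<Sum>i<2*n-1. create i * create (Suc i)) = (\<Sum>k<n. \<mu> k *\<^sub>R (D' (2 * k) * D' (2 * k + 1)))" ..
qed

text \<open>On supported functions the transfer operator is \<open>s\<close> times a product of
  commuting ladders. The same \<open>s\<close> serves every odd \<open>L\<close>, so that a single
  known trace determines it.\<close>

lemma fock_trace_transfer:
  fixes U :: "nat \<Rightarrow> nat \<Rightarrow> real" and n :: nat
  assumes row: "\<And>i j. i < 2 * n \<Longrightarrow> j < 2 * n \<Longrightarrow> (\<Sum>k<2*n. U i k * U j k) = of_bool (i = j)"
    and col: "\<And>i j. i < 2 * n \<Longrightarrow> j < 2 * n \<Longrightarrow> (\<Sum>k<2*n. U k i * U k j) = of_bool (i = j)"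
    and par: "\<And>i j. even i \<noteq> even j \<Longrightarrow> U i j = 0"
    and sing: "\<And>l m. l < n \<Longrightarrow> m < n \<Longrightarrow>
      (\<Sum>k<n. \<mu> k * (U (2 * k) (2 * l) * U (2 * k + 1) (2 * m + 1))) = of_bool (l = m) - of_bool (l = Suc m)"
  shows "\<exists>s. s * s = 1 \<and> (\<forall>L. odd L \<longrightarrow>
    fock_trace (2 * n) ((flip_all n annihilate create * chain (2 * n - 1)) ^ L) = s * (\<Prod>k<n. lucas (\<mu> k) L))"
proof -
  define D where "D = mode U (2 * n) annihilate"
  define D' where "D' = mode U (2 * n) create"
  define C' where "C' = flip_all n D D'"
  define V where "V = chain (2 * n - 1)"
  have car: "car (2 * n) D D'"
    unfolding D_def D'_def by (intro car_mode car_annihilate_create row)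
  have V: "V = ordered_prod (\<lambda>k. 1 + \<mu> k *\<^sub>R (D' (2 * k) * D' (2 * k + 1))) n"
    unfolding V_def D'_def by (intro chain_mode row par sing)
  have "\<exists>s. s * s = 1 \<and> (\<forall>f. supported (2 * n) f \<longrightarrow> app (flip_all n annihilate create) f = (\<lambda>S. s * app C' f S))"
    unfolding C'_def D_def D'_def by (rule flip_all_mode) (fact row col par)+
  then obtain s where s: "s * s = 1"
    "\<And>f. supported (2 * n) f \<Longrightarrow> app (flip_all n annihilate create) f = (\<lambda>S. s * app C' f S)"
    by blast
  have locs: "preserves (2 * n) C'" "preserves (2 * n) V"
    unfolding C'_def D_def D'_def V_def by (intro preserves_flip_all preserves_chain; auto)+
  have pow: "app ((flip_all n annihilate create * V) ^ L) f = (\<lambda>S. s ^ L * app ((C' * V) ^ L) f S)" if "supported (2 * n) f" for L f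
  proof (induction L)
    case (Suc L)
    have "app ((flip_all n annihilate create * V) ^ Suc L) f = app (flip_all n annihilate create) (app V (app ((flip_all n annihilate create * V) ^ L) f))"
      by simp
    also have "\<dots> = (\<lambda>S. s ^ L * app (flip_all n annihilate create) (app V (app ((C' * V) ^ L) f)) S)"
      unfolding Suc app_arg_scale ..
    also have "supported (2 * n) (app V (app ((C' * V) ^ L) f))"
      using that locs preserves_power[of "2 * n" "C' * V" L] by (simp add: preserves_def)
    from s(2)[OF this] have "(\<lambda>S. s ^ L * app (flip_all n annihilate create) (app V (app ((C' * V) ^ L) f)) S) =
        (\<lambda>S. s ^ Suc L * app ((C' * V) ^ Suc L) f S)"
      by (simp add: mult_ac)
    finally show ?case .
  qed simp
  have "fock_trace (2 * n) ((flip_all n annihilate create * V) ^ L) = s * (\<Prod>k<n. lucas (\<mu> k) L)" if "odd L" for L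
  proof -
    have "s ^ L = s"
      using that s(1) by (elim oddE) (simp add: power_mult power2_eq_square)
    moreover have "fock_trace (2 * n) ((flip_all n annihilate create * V) ^ L) = s ^ L * fock_trace (2 * n) ((C' * V) ^ L)"
      by (simp add: fock_trace_def pow supported_point_fn sum_distrib_left)
    moreover have "fock_trace (2 * n) ((C' * V) ^ L) = (\<Prod>k<n. lucas (\<mu> k) L)"
      unfolding C'_def V by (rule fock_trace_ladders_power[OF car that]) (auto simp: D_def D'_def)
    ultimately show ?thesis by simp
  qed
  with s(1) show ?thesis by (intro exI[of _ s]) (simp add: V_def)
qed

section \<open>Trigonometric sums and the singular values of the path\<close>

text \<open>Multiplication by \<open>2 * sin x\<close> makes the sum telescope.\<close>

lemma two_sin_sum_cos_odd:
  fixes x :: real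
  shows "2 * sin x * (\<Sum>l<n. cos ((2 * real l + 1) * x)) = sin (2 * real n * x)"
proof (induction n)
  case (Suc n)
  have "2 * sin x * cos ((2 * real n + 1) * x) = sin (2 * real (Suc n) * x) - sin (2 * real n * x)"
    using sin_times_cos[of x "(2 * real n + 1) * x"] sin_minus[of "2 * real n * x"]
    by (simp add: algebra_simps)
  with Suc show ?case by (simp add: algebra_simps)
qed simp

lemma two_sin_sum_cos_even:
  fixes x :: real
  shows "2 * sin x * (\<Sum>l<n. cos ((2 * real l + 2) * x)) = sin ((2 * real n + 1) * x) - sin x"
proof (induction n)
  case (Suc n)
  have "2 * sin x * cos ((2 * real n + 2) * x) = sin ((2 * real (Suc n) + 1) * x) - sin ((2 * real n + 1) * x)"
    using sin_times_cos[of x "(2 * real n + 2) * x"] sin_minus[of "(2 * real n + 1) * x"]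
    by (simp add: algebra_simps)
  with Suc show ?case by (simp add: algebra_simps)
qed simp

lemma sin_pi_frac_pos:
  assumes "0 < r" "r < 2 * n + 1"
  shows "sin (real r * pi / (2 * real n + 1)) > 0"
proof (rule sin_gt_zero)
  have "real r < 2 * real n + 1" using assms(2) by linarith
  then have "real r * pi < (2 * real n + 1) * pi"
    by (rule mult_strict_right_mono) simp
  then show "real r * pi / (2 * real n + 1) < pi"
    by (simp add: pos_divide_less_eq mult.commute)
qed (use assms in simp)

lemma sum_cos_even:
  assumes "0 < r" "r < 2 * n + 1"
  shows "(\<Sum>l<n. cos ((2 * real l + 2) * (real r * pi / (2 * real n + 1)))) = - 1 / 2"
proof -
  define x where "x = real r * pi / (2 * real n + 1)"
  have "(2 * real n + 1) * x = real r * pi"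
    by (simp add: x_def)
  then have "2 * sin x * (\<Sum>l<n. cos ((2 * real l + 2) * x)) = - sin x"
    unfolding two_sin_sum_cos_even by (simp add: sin_npi)
  moreover have "sin x > 0" unfolding x_def using assms by (rule sin_pi_frac_pos)
  ultimately have "sin x * (2 * (\<Sum>l<n. cos ((2 * real l + 2) * x)) + 1) = 0" "sin x \<noteq> 0"
    by (simp_all add: distrib_left mult_ac)
  then show ?thesis unfolding x_def[symmetric] by simp
qed

text \<open>The telescoped sum is \<open>sin (r * pi - x)\<close>, whose sign relative to
  \<open>sin x\<close> depends on the parity of \<open>r\<close>; the bounds on \<open>r\<close>
  keep \<open>sin x\<close> away from 0.\<close>

lemma sum_cos_odd:
  assumes "0 < r" "r < 2 * n + 1"
  shows "(\<Sum>l<n. cos ((2 * real l + 1) * (real r * pi / (2 * real n + 1)))) = - ((-1) ^ r / 2)"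
proof -
  define x where "x = real r * pi / (2 * real n + 1)"
  have "2 * real n * x = real r * pi - x"
    by (simp add: x_def field_simps)
  then have "2 * sin x * (\<Sum>l<n. cos ((2 * real l + 1) * x)) = - ((-1) ^ r * sin x)"
    unfolding two_sin_sum_cos_odd by (simp add: sin_diff sin_npi cos_npi)
  moreover have "sin x > 0" unfolding x_def using assms by (rule sin_pi_frac_pos)
  ultimately have "sin x * (2 * (\<Sum>l<n. cos ((2 * real l + 1) * x)) + (-1) ^ r) = 0" "sin x \<noteq> 0"
    by (simp_all add: distrib_left mult_ac)
  then show ?thesis unfolding x_def[symmetric] by simp
qed

text \<open>For \<open>k < n\<close> these are the angles of the path eigenvalues that lie strictly
  between 0 and \<open>pi / 2\<close>; the others are their reflections at
  \<open>pi / 2\<close>.\<close>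

definition mode_angle :: "nat \<Rightarrow> nat \<Rightarrow> real" where
  "mode_angle n k = real (Suc k) * pi / (2 * real n + 1)"

lemma mode_angle_eq: "mode_angle n k = (real k + 1) * (pi / (2 * real n + 1))"
  by (simp add: mode_angle_def)

text \<open>Reflecting an angle at \<open>pi / 2\<close> changes the sine of a multiple by a sign
  that depends only on the parity of the multiplier. For equal parities half of the
  \<open>2 * n\<close> angles therefore suffice, with 4 in place of the usual 2 in the
  normalisation.\<close>

lemma sum_sin_sin_modes:
  assumes "even a = even b" "0 < a" "0 < b" "a < 2 * n + 1" "b < 2 * n + 1"
  shows "4 / (2 * real n + 1) * (\<Sum>k<n. sin (real a * mode_angle n k) * sin (real b * mode_angle n k)) = of_bool (a = b)"
proof -
  define w where "w = pi / (2 * real n + 1)"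
  have *: "4 / (2 * real n + 1) * (\<Sum>k<n. sin (real a * mode_angle n k) * sin (real b * mode_angle n k)) = of_bool (a = b)"
    if "even a = even b" "0 < a" "a \<le> b" "b < 2 * n + 1" for a b
  proof -
    \<comment> \<open>Equal parity makes the difference and the sum of \<open>a\<close> and
      \<open>b\<close> even, namely \<open>2 * d\<close> and \<open>2 * (a + d)\<close>, so
      \<open>sum_cos_even\<close> applies to both.\<close>
    define d where "d = (b - a) div 2"
    have d: "b = a + 2 * d"
      unfolding d_def using that(1,3) by presburger
    have "(\<Sum>k<n. sin (real a * mode_angle n k) * sin (real b * mode_angle n k)) =
        ((\<Sum>k<n. cos ((2 * real k + 2) * (real d * pi / (2 * real n + 1)))) -
         (\<Sum>k<n. cos ((2 * real k + 2) * (real (a + d) * pi / (2 * real n + 1))))) / 2"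
    proof -
      have "sin (real a * mode_angle n k) * sin (real b * mode_angle n k) =
        (cos ((2 * real k + 2) * (real d * pi / (2 * real n + 1))) -
         cos ((2 * real k + 2) * (real (a + d) * pi / (2 * real n + 1)))) / 2" for k
      proof -
        have "real b * mode_angle n k - real a * mode_angle n k = (2 * real k + 2) * (real d * pi / (2 * real n + 1))"
          unfolding d mode_angle_eq times_divide_eq_right[symmetric] w_def[symmetric] by (simp add: algebra_simps)
        moreover have "real b * mode_angle n k + real a * mode_angle n k = (2 * real k + 2) * (real (a + d) * pi / (2 * real n + 1))"
          unfolding d mode_angle_eq times_divide_eq_right[symmetric] w_def[symmetric] by (simp add: algebra_simps)
        ultimately show ?thesis
          using sin_times_sin[of "real b * mode_angle n k" "real a * mode_angle n k"] by (simp add: mult.commute)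
      qed
      then show ?thesis
        by (simp only: sum_subtractf[symmetric] sum_divide_distrib)
    qed
    also have "(\<Sum>k<n. cos ((2 * real k + 2) * (real (a + d) * pi / (2 * real n + 1)))) = - 1 / 2"
      by (rule sum_cos_even) (use that d in auto)
    also have "(\<Sum>k<n. cos ((2 * real k + 2) * (real d * pi / (2 * real n + 1)))) = (if d = 0 then real n else - 1 / 2)"
      using sum_cos_even[of d n] that d by auto
    finally show ?thesis
      using d by (auto simp: field_simps)
  qed
  show ?thesis
    using *[of a b] *[of b a] assms by (cases "a \<le> b") (auto simp: mult.commute)
qed

text \<open>The values 1 and 2 of \<open>e\<close> stand for the even and odd sites: sites are
  numbered from 0, while the sine vectors of a path start at 1.\<close>

lemma sum_sin_sin_sites:
  assumes "k < n" "k' < n" "e = 1 \<or> e = 2"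
  shows "4 / (2 * real n + 1) * (\<Sum>l<n. sin (real (2 * l + e) * mode_angle n k) * sin (real (2 * l + e) * mode_angle n k')) =
    of_bool (k = k')"
proof -
  define w where "w = pi / (2 * real n + 1)"
  have *: "4 / (2 * real n + 1) * (\<Sum>l<n. sin (real (2 * l + e) * mode_angle n k) * sin (real (2 * l + e) * mode_angle n k')) =
      of_bool (k = k')"
    if "k \<le> k'" "k' < n" for k k'
  proof -
    define c where "c r = (\<Sum>l<n. cos ((2 * real l + real e) * (real r * pi / (2 * real n + 1))))" for r
    have "(\<Sum>l<n. sin (real (2 * l + e) * mode_angle n k) * sin (real (2 * l + e) * mode_angle n k')) =
        (c (k' - k) - c (k + k' + 2)) / 2"
    proof -
      have "sin (real (2 * l + e) * mode_angle n k) * sin (real (2 * l + e) * mode_angle n k') =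
        (cos ((2 * real l + real e) * (real (k' - k) * pi / (2 * real n + 1))) -
         cos ((2 * real l + real e) * (real (k + k' + 2) * pi / (2 * real n + 1)))) / 2" for l
      proof -
        have "real (2 * l + e) * mode_angle n k' - real (2 * l + e) * mode_angle n k =
            (2 * real l + real e) * (real (k' - k) * pi / (2 * real n + 1))"
          using that unfolding mode_angle_eq times_divide_eq_right[symmetric] w_def[symmetric] by (simp add: algebra_simps of_nat_diff)
        moreover have "real (2 * l + e) * mode_angle n k' + real (2 * l + e) * mode_angle n k =
            (2 * real l + real e) * (real (k + k' + 2) * pi / (2 * real n + 1))"
          unfolding mode_angle_eq times_divide_eq_right[symmetric] w_def[symmetric] by (simp add: algebra_simps)
        ultimately show ?thesis
          using sin_times_sin[of "real (2 * l + e) * mode_angle n k'" "real (2 * l + e) * mode_angle n k"]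
          by (simp add: mult.commute)
      qed
      then show ?thesis
        by (simp only: c_def sum_subtractf[symmetric] sum_divide_distrib)
    qed
    moreover have c: "c r = (if e = 1 then - ((-1) ^ r / 2) else - 1 / 2)" if "0 < r" "r < 2 * n + 1" for r
      using assms(3) sum_cos_odd[OF that] sum_cos_even[OF that] by (auto simp: c_def)
    have "c (k' - k) - c (k + k' + 2) = of_bool (k = k') * (real n + 1 / 2)"
    proof (cases "k = k'")
      case True
      moreover have "c 0 = real n" by (simp add: c_def)
      ultimately show ?thesis using that c[of "k + k' + 2"] by auto
    next
      case False
      \<comment> \<open>Difference and sum have the same parity, so the two cosine sums cancel also
        for \<open>e = 1\<close>.\<close>
      have "(-1 :: real) ^ (k' - k) = (-1) ^ (k + k' + 2)"
        using that by (auto simp: minus_one_power_iff)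
      with False that show ?thesis by (simp add: c)
    qed
    ultimately show ?thesis by (simp only:) (simp add: field_simps)
  qed
  show ?thesis
    using *[of k k'] *[of k' k] assms by (cases "k \<le> k'") (auto simp: mult.commute)
qed

text \<open>Row \<open>2k\<close> and row \<open>2k + 1\<close> hold the left and right singular vectors of the signed adjacency matrix between
  even and odd sites of the path, for the singular value \<open>2 cos (mode_angle n k)\<close>.\<close>

definition sine_matrix :: "nat \<Rightarrow> nat \<Rightarrow> nat \<Rightarrow> real" where
  "sine_matrix n j i = (if even j = even i then
     2 / sqrt (2 * real n + 1) * ((-1) ^ (i div 2) * sin (real (Suc i) * mode_angle n (j div 2))) else 0)"

lemma sine_matrix_mult:
  assumes "even j = even i" "even j' = even i'"
  shows "sine_matrix n j i * sine_matrix n j' i' = (-1) ^ (i div 2 + i' div 2) * (4 / (2 * real n + 1) *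
     (sin (real (Suc i) * mode_angle n (j div 2)) * sin (real (Suc i') * mode_angle n (j' div 2))))"
proof -
  have "sqrt (2 * real n + 1) * sqrt (2 * real n + 1) = 2 * real n + 1" by simp
  then have "2 / sqrt (2 * real n + 1) * (2 / sqrt (2 * real n + 1)) = 4 / (2 * real n + 1)"
    by (simp add: divide_simps)
  then show ?thesis
    using assms unfolding sine_matrix_def by (simp add: power_add)
qed

lemma sum_by_parity:
  fixes g :: "nat \<Rightarrow> real"
  assumes "\<And>i. even i \<noteq> even j \<Longrightarrow> g i = 0"
  shows "(\<Sum>i<2*n. g i) = (\<Sum>l<n. g (2 * l + j mod 2))"
  unfolding sum_odd_even sum.distrib using assms
  by (cases "even j") (auto simp: odd_iff_mod_2_eq_one even_iff_mod_2_eq_zero)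

lemma sine_matrix_parity: "even i \<noteq> even j \<Longrightarrow> sine_matrix n i j = 0"
  by (simp add: sine_matrix_def)

lemma sine_matrix_rows:
  assumes "i < 2 * n" "j < 2 * n"
  shows "(\<Sum>k<2*n. sine_matrix n i k * sine_matrix n j k) = of_bool (i = j)"
proof (cases "even i = even j")
  case True
  then have m: "i mod 2 = j mod 2" by (simp add: parity_cases mod2_eq_if)
  have "(\<Sum>k<2*n. sine_matrix n i k * sine_matrix n j k) = (\<Sum>l<n. sine_matrix n i (2 * l + i mod 2) * sine_matrix n j (2 * l + i mod 2))"
    by (rule sum_by_parity) (auto simp: sine_matrix_parity)
  also have "\<dots> = (\<Sum>l<n. 4 / (2 * real n + 1) *
      (sin (real (2 * l + Suc (i mod 2)) * mode_angle n (i div 2)) * sin (real (2 * l + Suc (i mod 2)) * mode_angle n (j div 2))))"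
    by (intro sum.cong refl, subst sine_matrix_mult) (use True in \<open>auto simp flip: mult_2\<close>)
  also have "\<dots> = of_bool (i div 2 = j div 2)"
    unfolding sum_distrib_left[symmetric]
    by (rule sum_sin_sin_sites) (use assms in auto)
  also have "(i div 2 = j div 2) = (i = j)"
    using m by (metis div_mult_mod_eq)
  finally show ?thesis .
next
  case False
  then have "sine_matrix n i k * sine_matrix n j k = 0" for k
    by (cases "even k") (auto simp: sine_matrix_parity)
  then have "(\<Sum>k<2*n. sine_matrix n i k * sine_matrix n j k) = 0"
    by (simp only: sum.neutral_const)
  with False show ?thesis by auto
qed

lemma sine_matrix_cols:
  assumes "i < 2 * n" "j < 2 * n"
  shows "(\<Sum>k<2*n. sine_matrix n k i * sine_matrix n k j) = of_bool (i = j)"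
proof (cases "even i = even j")
  case True
  have "(\<Sum>k<2*n. sine_matrix n k i * sine_matrix n k j) = (\<Sum>l<n. sine_matrix n (2 * l + i mod 2) i * sine_matrix n (2 * l + i mod 2) j)"
    by (rule sum_by_parity) (auto simp: sine_matrix_parity)
  also have "\<dots> = (\<Sum>l<n. (-1) ^ (i div 2 + j div 2) * (4 / (2 * real n + 1) *
      (sin (real (Suc i) * mode_angle n l) * sin (real (Suc j) * mode_angle n l))))"
    by (intro sum.cong refl, subst sine_matrix_mult) (use True in auto)
  also have "\<dots> = (-1) ^ (i div 2 + j div 2) * (4 / (2 * real n + 1) *
      (\<Sum>l<n. (sin (real (Suc i) * mode_angle n l) * sin (real (Suc j) * mode_angle n l))))"
    by (simp only: sum_distrib_left)
  also have "\<dots> = (-1) ^ (i div 2 + j div 2) * of_bool (Suc i = Suc j)"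
    by (subst sum_sin_sin_modes) (use assms True in auto)
  also have "\<dots> = of_bool (i = j)"
    by (auto simp flip: mult_2)
  finally show ?thesis .
next
  case False
  then have "sine_matrix n k i * sine_matrix n k j = 0" for k
    by (cases "even k") (auto simp: sine_matrix_parity)
  then have "(\<Sum>k<2*n. sine_matrix n k i * sine_matrix n k j) = 0"
    by (simp only: sum.neutral_const)
  with False show ?thesis by auto
qed

text \<open>Multiplying by \<open>2 * cos\<close> the sine at an odd site gives the sum over its two
  even neighbours. Orthogonality over the modes picks \<open>l = m\<close> or
  \<open>l = Suc m\<close>, and \<open>(-1) ^ (l + m)\<close> makes the second term
  negative.\<close>

lemma sine_matrix_singular:
  assumes "l < n" "m < n"
  shows "(\<Sum>k<n. 2 * cos (mode_angle n k) * (sine_matrix n (2 * k) (2 * l) * sine_matrix n (2 * k + 1) (2 * m + 1))) =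
    of_bool (l = m) - of_bool (l = Suc m)"
proof -
  define c where "c b = 4 / (2 * real n + 1) * (\<Sum>k<n. sin (real (2 * l + 1) * mode_angle n k) * sin (real b * mode_angle n k))" for b
  have "2 * cos (mode_angle n k) * (sine_matrix n (2 * k) (2 * l) * sine_matrix n (2 * k + 1) (2 * m + 1)) =
      (-1) ^ (l + m) * (4 / (2 * real n + 1) * (sin (real (2 * l + 1) * mode_angle n k) * sin (real (2 * m + 1) * mode_angle n k)) +
      4 / (2 * real n + 1) * (sin (real (2 * l + 1) * mode_angle n k) * sin (real (2 * m + 3) * mode_angle n k)))" for k
  proof -
    have "2 * cos (mode_angle n k) * sin (real (2 * m + 2) * mode_angle n k) =
        sin (real (2 * m + 1) * mode_angle n k) + sin (real (2 * m + 3) * mode_angle n k)"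
      using sin_times_cos[of "real (2 * m + 2) * mode_angle n k" "mode_angle n k"] by (simp add: algebra_simps)
    note product = this
    have "2 * cos (mode_angle n k) * (sine_matrix n (2 * k) (2 * l) * sine_matrix n (2 * k + 1) (2 * m + 1)) =
        (-1) ^ (l + m) * (4 / (2 * real n + 1) * (sin (real (2 * l + 1) * mode_angle n k) *
          (2 * cos (mode_angle n k) * sin (real (2 * m + 2) * mode_angle n k))))"
      by (subst sine_matrix_mult) (simp_all add: mult_ac)
    then show ?thesis unfolding product by (simp only: distrib_left)
  qed
  then have "(\<Sum>k<n. 2 * cos (mode_angle n k) * (sine_matrix n (2 * k) (2 * l) * sine_matrix n (2 * k + 1) (2 * m + 1))) =
      (-1) ^ (l + m) * (c (2 * m + 1) + c (2 * m + 3))"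
    by (simp only: c_def sum_distrib_left[symmetric] sum.distrib)
  also have "c (2 * m + 1) = of_bool (l = m)"
    unfolding c_def by (subst sum_sin_sin_modes) (use assms in auto)
  \<comment> \<open>For the last odd site the right neighbour lies beyond the path, where all sines
    vanish.\<close>
  also have "c (2 * m + 3) = of_bool (l = Suc m)"
  proof (cases "Suc m < n")
    case True
    then show ?thesis
      unfolding c_def by (subst sum_sin_sin_modes) (use assms in auto)
  next
    case False
    then have n: "n = Suc m" using assms by simp
    have "sin (real (2 * m + 3) * mode_angle n k) = 0" for k
    proof -
      have "real (2 * m + 3) * mode_angle n k = real (Suc k) * pi"
        by (simp add: n mode_angle_def field_simps)
      then show ?thesis by (simp only: sin_npi)
    qed
    then show ?thesis using assms n by (simp add: c_def)
  qed
  finally show ?thesis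
    by (auto simp flip: mult_2)
qed

section \<open>Lucas polynomials\<close>

text \<open>The polynomial \<open>\<mu> * lucas \<mu> (2 * m + 1)\<close> in the variable \<open>\<mu>\<^sup>2\<close>, whose roots are read off at \<open>\<mu> = 2 i cos t\<close>.\<close>

fun lucas_poly :: "nat \<Rightarrow> real poly" where
  "lucas_poly 0 = [:0, 1:]"
| "lucas_poly (Suc 0) = [:0, 3, 1:]"
| "lucas_poly (Suc (Suc m)) = [:2, 1:] * lucas_poly (Suc m) - lucas_poly m"

text \<open>A double step of the recurrence: for \<open>\<mu> = z - 1/z\<close> the factor is
  \<open>z^2 + 1/z^2\<close>.\<close>

lemma lucas_step: "lucas \<mu> (k + 4) = (\<mu>\<^sup>2 + 2) * lucas \<mu> (k + 2) - lucas \<mu> k"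
  by (simp add: eval_nat_numeral algebra_simps)

lemma poly_lucas_poly_lucas: "poly (lucas_poly m) (\<mu>\<^sup>2) = \<mu> * lucas \<mu> (2 * m + 1)"
proof (induction m rule: lucas_poly.induct)
  case (3 m)
  have "lucas \<mu> (2 * Suc (Suc m) + 1) = (\<mu>\<^sup>2 + 2) * lucas \<mu> (2 * Suc m + 1) - lucas \<mu> (2 * m + 1)"
    using lucas_step[of \<mu> "2 * m + 1"] by (simp add: eval_nat_numeral)
  then show ?case
    unfolding lucas_poly.simps poly_diff poly_mult 3 by (simp only:) (simp add: algebra_simps del: lucas.simps)
qed (simp_all add: eval_nat_numeral algebra_simps)

text \<open>The case \<open>z = i * exp (i * t)\<close>, where \<open>\<mu> = 2 * i * cos t\<close>,
  stated within the reals. The recurrence becomes the addition formula for the cosine.\<close>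

lemma poly_lucas_poly_cos:
  "poly (lucas_poly m) (- (4 * (cos t)\<^sup>2)) = (-1) ^ Suc m * (4 * cos t * cos ((2 * real m + 1) * t))"
proof (induction m rule: lucas_poly.induct)
  case 1
  show ?case by (simp add: power2_eq_square)
next
  case 2
  have "cos (3 * t) = 4 * cos t ^ 3 - 3 * cos t"
    by (rule cos_treble_cos)
  moreover have "(2 * real (Suc 0) + 1) * t = 3 * t" by simp
  ultimately show ?case
    by (simp only: lucas_poly.simps) (simp add: power2_eq_square power3_eq_cube algebra_simps)
next
  case (3 m)
  define a where "a = (2 * real m + 3) * t"
  have c2: "cos (2 * t) = 2 * (cos t)\<^sup>2 - 1"
    by (rule cos_double_cos)
  have "cos (a + 2 * t) + cos (a - 2 * t) = 2 * cos (2 * t) * cos a"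
    by (simp add: cos_add cos_diff)
  then have rec: "cos (a + 2 * t) = (4 * (cos t)\<^sup>2 - 2) * cos a - cos (a - 2 * t)"
    unfolding c2 by (simp add: algebra_simps)
  have args: "(2 * real (Suc (Suc m)) + 1) * t = a + 2 * t" "(2 * real (Suc m) + 1) * t = a"
    "(2 * real m + 1) * t = a - 2 * t"
    by (simp_all add: a_def algebra_simps)
  from 3 show ?case
    unfolding lucas_poly.simps poly_diff poly_mult args rec by (simp add: algebra_simps)
qed

lemma lucas_poly_monic: "degree (lucas_poly m) \<le> Suc m \<and> coeff (lucas_poly m) (Suc m) = 1"
proof (induction m rule: lucas_poly.induct)
  case (3 m)
  have eq: "[:2, 1:] * lucas_poly (Suc m) = smult 2 (lucas_poly (Suc m)) + pCons 0 (lucas_poly (Suc m))"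
    by simp
  have "degree ([:2, 1:] * lucas_poly (Suc m)) \<le> Suc (Suc (Suc m))"
    using 3 degree_mult_le[of "[:2, 1:]" "lucas_poly (Suc m)"] by (simp del: mult_pCons_left)
  moreover have "degree (lucas_poly m) < Suc (Suc (Suc m))" "degree (lucas_poly (Suc m)) < Suc (Suc (Suc m))"
    using 3 by auto
  ultimately show ?case
    using 3 by (auto intro!: degree_diff_le simp: coeff_eq_0 simp del: mult_pCons_left simp: eq)
qed auto

lemma odd_upto_eq: "{j::nat. odd j \<and> j \<le> 2 * m + 1} = (\<lambda>i. 2 * i + 1) ` {..m}"
  by (auto elim!: oddE)

text \<open>As polynomials in \<open>\<mu>\<^sup>2\<close> both sides are monic of degree
  \<open>m + 1\<close> with the same \<open>m + 1\<close> distinct roots.\<close>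

lemma lucas_product:
  "(\<Prod>j\<in>{j::nat. odd j \<and> j \<le> 2 * m + 1}. 4 * (cos (real j * pi / (4 * real m + 2)))\<^sup>2 + \<mu>\<^sup>2) =
    \<mu> * lucas \<mu> (2 * m + 1)"
proof -
  define t where "t i = (2 * real i + 1) * pi / (4 * real m + 2)" for i
  define z where "z i = - (4 * (cos (t i))\<^sup>2)" for i
  define p where "p = (\<Prod>i\<le>m. [:- z i, 1:])"
  have t: "0 < t i" "t i \<le> pi / 2" if "i \<le> m" for i
  proof -
    have "(2 * real i + 1) * pi \<le> (2 * real m + 1) * pi"
      using that by (intro mult_right_mono) auto
    then show "t i \<le> pi / 2" by (simp add: t_def field_simps)
    show "0 < t i" by (simp add: t_def add_pos_nonneg)
  qed
  \<comment> \<open>The angles lie in (0, \<open>pi / 2\<close>], where the cosine is nonnegative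
    and injective, hence its square is injective too.\<close>
  have inj: "inj_on z {..m}"
  proof (rule inj_onI)
    fix i j assume ij: "i \<in> {..m}" "j \<in> {..m}" "z i = z j"
    then have "(cos (t i))\<^sup>2 = (cos (t j))\<^sup>2" by (simp add: z_def)
    moreover have "cos (t i) \<ge> 0" "cos (t j) \<ge> 0"
      using ij t[of i] t[of j] pi_gt_zero by (auto intro!: cos_ge_zero simp del: pi_gt_zero)
    ultimately have "cos (t i) = cos (t j)" by simp
    moreover have "0 \<le> t i" "t i \<le> pi" "0 \<le> t j" "t j \<le> pi"
      using ij t[of i] t[of j] pi_gt_zero by (simp_all del: pi_gt_zero)
    ultimately have "t i = t j"
      using cos_inj_pi by blast
    then have "(2 * real i + 1) * pi = (2 * real j + 1) * pi"
      by (simp add: t_def field_simps)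
    then show "i = j" by simp
  qed
  have "lucas_poly m = p"
  proof (rule poly_eqI_degree_lead_coeff[where n = "Suc m" and A = "z ` {..m}"])
    have deg: "degree p = Suc m"
      unfolding p_def by (subst degree_prod_sum_eq) auto
    have "lead_coeff p = 1"
      unfolding p_def by (simp add: lead_coeff_prod)
    then show "coeff (lucas_poly m) (Suc m) = coeff p (Suc m)"
      using lucas_poly_monic[of m] by (simp add: deg)
    show "degree p \<le> Suc m" using deg by simp
    show "degree (lucas_poly m) \<le> Suc m" using lucas_poly_monic by blast
    show "Suc m \<le> card (z ` {..m})" by (simp add: card_image inj)
    show "poly (lucas_poly m) x = poly p x" if x: "x \<in> z ` {..m}" for x
    proof -
      obtain i where i: "i \<le> m" "x = z i" using x by auto
      \<comment> \<open>The angles are chosen so that this is an odd multiple of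
        \<open>pi / 2\<close>.\<close>
      have "(2 * real m + 1) * t i = real (2 * i + 1) * (pi / 2)"
        by (simp add: t_def field_simps)
      moreover have "cos (real (2 * i + 1) * (pi / 2)) = 0"
        unfolding cos_zero_iff by (intro disjI1 exI[of _ "2 * i + 1"]) simp
      ultimately have "cos ((2 * real m + 1) * t i) = 0" by (simp only:)
      then have "poly (lucas_poly m) x = 0"
        unfolding i z_def poly_lucas_poly_cos by simp
      moreover have "poly p x = 0"
        using i by (auto simp: p_def poly_prod intro!: bexI[of _ i])
      ultimately show ?thesis by simp
    qed
  qed
  then have "\<mu> * lucas \<mu> (2 * m + 1) = (\<Prod>i\<le>m. \<mu>\<^sup>2 - z i)"
    unfolding poly_lucas_poly_lucas[symmetric] p_def by (simp add: poly_prod)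
  also have "\<dots> = (\<Prod>j\<in>{j::nat. odd j \<and> j \<le> 2 * m + 1}. 4 * (cos (real j * pi / (4 * real m + 2)))\<^sup>2 + \<mu>\<^sup>2)"
    unfolding odd_upto_eq by (subst prod.reindex) (auto simp: inj_on_def z_def t_def add.commute)
  finally show ?thesis ..
qed

section \<open>Closed walks of the transfer operator\<close>

text \<open>The sites of a column are covered by the edges \<open>R\<close> from the left, the dimers \<open>E\<close> and the edges \<open>S\<close> to the
  right.\<close>

definition column :: "nat \<Rightarrow> nat set \<Rightarrow> nat set \<Rightarrow> nat set \<Rightarrow> bool" where
  "column H R E S \<longleftrightarrow> R \<inter> S = {} \<and> R \<inter> dimer_cover E = {} \<and> dimer_cover E \<inter> S = {} \<and> R \<union> dimer_cover E \<union> S = {..<H}"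

definition steps :: "nat \<Rightarrow> nat set \<Rightarrow> nat set \<Rightarrow> nat set set" where
  "steps H R S = {E \<in> dimers (H - 1). column H R E S}"

lemma finite_steps [simp]: "finite (steps H R S)"
  by (simp add: steps_def)

definition transfer :: "nat \<Rightarrow> fock_op" where
  "transfer n = flip_all n annihilate create * chain (2 * n - 1)"

lemma preserves_transfer: "preserves (2 * n) (transfer n)"
  unfolding transfer_def by (intro preserves_mult preserves_flip_all preserves_chain) auto

text \<open>Complementing \<open>R\<close> leaves the sites not covered from the left, removing
  dimers leaves the edges \<open>S\<close> to the right. So the matrix entries of the transfer
  operator count the fillings of one column.\<close>

lemma app_transfer:
  assumes "supported (2 * n) f" "R \<subseteq> {..<2 * n}"
  shows "app (transfer n) f R = (\<Sum>S\<in>Pow {..<2 * n}. real (card (steps (2 * n) R S)) * f S)"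
proof -
  define A where "A = {E \<in> dimers (2 * n - 1). dimer_cover E \<subseteq> {..<2 * n} - R}"
  define g where "g E = {..<2 * n} - R - dimer_cover E" for E
  have "(R - {..<2 * n}) \<union> ({..<2 * n} - R) = {..<2 * n} - R" using assms(2) by auto
  then have "app (transfer n) f R = (\<Sum>E\<in>A. f (g E))"
    by (simp add: transfer_def app_flip_all chain_def app_chain A_def g_def)
  also have "\<dots> = (\<Sum>S\<in>Pow {..<2 * n}. \<Sum>E\<in>{E \<in> A. g E = S}. f (g E))"
    by (rule sum.group[symmetric]) (auto simp: A_def g_def)
  also have "\<dots> = (\<Sum>S\<in>Pow {..<2 * n}. real (card (steps (2 * n) R S)) * f S)"
  proof (rule sum.cong[OF refl])
    fix S assume "S \<in> Pow {..<2 * n}"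
    then have "{E \<in> A. g E = S} = steps (2 * n) R S"
      using assms(2) unfolding A_def g_def steps_def column_def by blast
    moreover have "(\<Sum>E\<in>{E \<in> A. g E = S}. f (g E)) = (\<Sum>E\<in>{E \<in> A. g E = S}. f S)"
      by (rule sum.cong) auto
    ultimately show "(\<Sum>E\<in>{E \<in> A. g E = S}. f (g E)) = real (card (steps (2 * n) R S)) * f S"
      by simp
  qed
  finally show ?thesis .
qed

lemma app_power_paths:
  fixes k :: "nat set \<Rightarrow> nat set \<Rightarrow> real"
  assumes "preserves H T"
    and k: "\<And>f R. supported H f \<Longrightarrow> R \<subseteq> {..<H} \<Longrightarrow> app T f R = (\<Sum>S\<in>Pow {..<H}. k R S * f S)"
    and "supported H f" "R \<subseteq> {..<H}"
  shows "app (T ^ L) f R = (\<Sum>s\<in>{s \<in> {..L} \<rightarrow>\<^sub>E Pow {..<H}. s 0 = R}. (\<Prod>t<L. k (s t) (s (Suc t))) * f (s L))"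
  using assms(3)
proof (induction L arbitrary: f)
  case 0
  have "{s \<in> {..0::nat} \<rightarrow>\<^sub>E Pow {..<H}. s 0 = R} = {\<lambda>t\<in>{..0::nat}. R}"
    using assms(4) by (auto simp: PiE_iff extensional_def fun_eq_iff)
  then show ?case by simp
next
  case (Suc L)
  define A where "A L = {s \<in> {..L} \<rightarrow>\<^sub>E Pow {..<H}. s 0 = R}" for L :: nat
  have "supported H (app T f)" using Suc.prems assms(1) by (simp add: preserves_def)
  have "app (T ^ Suc L) f R = app (T ^ L) (app T f) R"
    by (simp add: power_Suc2 del: power_Suc)
  also have "\<dots> = (\<Sum>s\<in>A L. (\<Prod>t<L. k (s t) (s (Suc t))) * app T f (s L))"
    unfolding A_def by (rule Suc.IH) fact
  also have "\<dots> = (\<Sum>s\<in>A L. \<Sum>S\<in>Pow {..<H}. (\<Prod>t<L. k (s t) (s (Suc t))) * k (s L) S * f S)"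
  proof (rule sum.cong[OF refl])
    fix s assume "s \<in> A L"
    then have "s L \<subseteq> {..<H}" by (auto simp: A_def PiE_iff)
    then show "(\<Prod>t<L. k (s t) (s (Suc t))) * app T f (s L) =
        (\<Sum>S\<in>Pow {..<H}. (\<Prod>t<L. k (s t) (s (Suc t))) * k (s L) S * f S)"
      by (simp add: k Suc.prems sum_distrib_left mult.assoc)
  qed
  also have "\<dots> = (\<Sum>(s, S)\<in>A L \<times> Pow {..<H}. (\<Prod>t<L. k (s t) (s (Suc t))) * k (s L) S * f S)"
    by (rule sum.cartesian_product)
  also have "\<dots> = (\<Sum>s\<in>A (Suc L). (\<Prod>t<Suc L. k (s t) (s (Suc t))) * f (s (Suc L)))"
  proof (rule sum.reindex_bij_witness[of _ "\<lambda>s. (restrict s {..L}, s (Suc L))" "\<lambda>(s, S). s(Suc L := S)"])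
    fix p assume "p \<in> A L \<times> Pow {..<H}"
    then obtain s S where p: "p = (s, S)" and s: "s \<in> {..L} \<rightarrow>\<^sub>E Pow {..<H}" "s 0 = R" and S: "S \<subseteq> {..<H}"
      by (auto simp: A_def)
    have "restrict (s(Suc L := S)) {..L} = s"
      using s(1) by (intro ext) (auto simp: PiE_iff extensional_def restrict_def)
    then show "(restrict ((\<lambda>(s, S). s(Suc L := S)) p) {..L}, (\<lambda>(s, S). s(Suc L := S)) p (Suc L)) = p"
      by (simp add: p)
    show "(\<lambda>(s, S). s(Suc L := S)) p \<in> A (Suc L)"
      using s S by (auto simp: A_def p PiE_iff extensional_def)
    have "(\<Prod>t<L. k ((s(Suc L := S)) t) ((s(Suc L := S)) (Suc t))) = (\<Prod>t<L. k (s t) (s (Suc t)))"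
      by (rule prod.cong) auto
    then show "(\<Prod>t<Suc L. k ((\<lambda>(s, S). s(Suc L := S)) p t) ((\<lambda>(s, S). s(Suc L := S)) p (Suc t))) *
          f ((\<lambda>(s, S). s(Suc L := S)) p (Suc L)) =
        (case p of (s, S) \<Rightarrow> (\<Prod>t<L. k (s t) (s (Suc t))) * k (s L) S * f S)"
      by (simp add: p)
  next
    fix s assume "s \<in> A (Suc L)"
    then show "(\<lambda>(s, S). s(Suc L := S)) (restrict s {..L}, s (Suc L)) = s"
      "(restrict s {..L}, s (Suc L)) \<in> A L \<times> Pow {..<H}"
      by (auto simp: A_def PiE_iff extensional_def fun_eq_iff le_Suc_eq)
  qed
  finally show ?case by (simp only: A_def)
qed

lemma fock_trace_power_closed_paths:
  fixes k :: "nat set \<Rightarrow> nat set \<Rightarrow> real"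
  assumes "preserves H T"
    and k: "\<And>f R. supported H f \<Longrightarrow> R \<subseteq> {..<H} \<Longrightarrow> app T f R = (\<Sum>S\<in>Pow {..<H}. k R S * f S)"
  shows "fock_trace H (T ^ L) = (\<Sum>s\<in>{s \<in> {..L} \<rightarrow>\<^sub>E Pow {..<H}. s L = s 0}. \<Prod>t<L. k (s t) (s (Suc t)))"
proof -
  define A where "A = ({..L} \<rightarrow>\<^sub>E Pow {..<H})"
  have [simp]: "finite A" unfolding A_def by (intro finite_PiE) auto
  have "fock_trace H (T ^ L) = (\<Sum>R\<in>Pow {..<H}. \<Sum>s\<in>{s \<in> A. s 0 = R}. (\<Prod>t<L. k (s t) (s (Suc t))) * point_fn R (s L))"
    unfolding fock_trace_def A_def
    by (intro sum.cong refl app_power_paths[OF assms]) (auto simp: supported_point_fn)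
  also have "\<dots> = (\<Sum>R\<in>Pow {..<H}. \<Sum>s\<in>{s \<in> A. s 0 = R}. (\<Prod>t<L. k (s t) (s (Suc t))) * point_fn (s 0) (s L))"
    by (intro sum.cong refl) auto
  also have "\<dots> = (\<Sum>s\<in>A. (\<Prod>t<L. k (s t) (s (Suc t))) * point_fn (s 0) (s L))"
  proof (rule sum.group)
    show "(\<lambda>s. s 0) ` A \<subseteq> Pow {..<H}" by (auto simp: A_def PiE_iff)
  qed simp_all
  also have "\<dots> = (\<Sum>s\<in>{s \<in> A. s L = s 0}. \<Prod>t<L. k (s t) (s (Suc t)))"
    by (rule sum.mono_neutral_cong_right) (auto simp: point_fn_def)
  finally show ?thesis by (simp only: A_def)
qed

text \<open>The walk \<open>s\<close> lists the horizontal edges entering each column; its extra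
  entry at \<open>L\<close> repeats the wrap edges \<open>s 0\<close>. The second component chooses
  the vertical dimers of each column.\<close>

definition configs :: "nat \<Rightarrow> nat \<Rightarrow> ((nat \<Rightarrow> nat set) \<times> (nat \<Rightarrow> nat set)) set" where
  "configs L H = (SIGMA s:{s \<in> {..L} \<rightarrow>\<^sub>E Pow {..<H}. s L = s 0}. \<Pi>\<^sub>E t\<in>{..<L}. steps H (s t) (s (Suc t)))"

lemma fock_trace_transfer_power: "fock_trace (2 * n) (transfer n ^ L) = real (card (configs L (2 * n)))"
proof -
  have fin: "finite {s \<in> {..L} \<rightarrow>\<^sub>E Pow {..<2 * n}. s L = s 0}"
    by (rule finite_subset[of _ "{..L} \<rightarrow>\<^sub>E Pow {..<2 * n}"]) (auto intro: finite_PiE)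
  have "fock_trace (2 * n) (transfer n ^ L) =
      (\<Sum>s\<in>{s \<in> {..L} \<rightarrow>\<^sub>E Pow {..<2 * n}. s L = s 0}. \<Prod>t<L. real (card (steps (2 * n) (s t) (s (Suc t)))))"
    by (rule fock_trace_power_closed_paths[OF preserves_transfer app_transfer])
  also have "\<dots> = real (card (configs L (2 * n)))"
    unfolding configs_def by (subst card_SigmaI) (auto simp: fin card_PiE intro!: finite_PiE)
  finally show ?thesis .
qed

text \<open>The cylinder with one column: its wrap edges are loops, and a path on \<open>2 * n\<close> sites has one perfect matching.\<close>

lemma steps_self: "card (steps (2 * n) R R) = of_bool (R = {})"
proof (cases "R = {}")
  case True
  \<comment> \<open>Site 0 can only be covered by dimer 0, and this forces all other dimers
    upwards.\<close>
  define E0 where "E0 = {i. even i \<and> i < 2 * n}"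
  have "steps (2 * n) {} {} = {E0}"
  proof (intro equalityI subsetI)
    fix E assume "E \<in> steps (2 * n) {} {}"
    then have E: "\<And>i. i \<in> E \<Longrightarrow> Suc i \<notin> E" "E \<union> Suc ` E = {..<2 * n}"
      by (auto simp: steps_def column_def dimer_cover_def dimers_def)
    have "i < 2 * n \<Longrightarrow> i \<in> E \<longleftrightarrow> even i" for i
    proof (induction i)
      case 0
      then have "0 \<in> E \<union> Suc ` E" using E(2) by auto
      then show ?case by auto
    next
      case (Suc i)
      then have "Suc i \<in> E \<union> Suc ` E" using E(2) by auto
      then have "Suc i \<in> E \<or> i \<in> E" by auto
      then show ?case using Suc E(1)[of i] by auto
    qed
    moreover have "E \<subseteq> {..<2 * n}" using E(2) by auto
    ultimately have "E = E0" by (auto simp: E0_def)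
    then show "E \<in> {E0}" by simp
  next
    fix E assume "E \<in> {E0}"
    have "E0 \<subseteq> {..<2 * n - 1}"
    proof
      fix i assume "i \<in> E0"
      then show "i \<in> {..<2 * n - 1}" unfolding E0_def by (cases "i = 2 * n - 1") auto
    qed
    moreover have "E0 \<union> Suc ` E0 = {..<2 * n}"
    proof (intro equalityI subsetI)
      fix i assume i: "i \<in> {..<2 * n}"
      show "i \<in> E0 \<union> Suc ` E0"
      proof (cases "even i")
        case False
        then obtain j where "i = Suc j" "even j" by (cases i) auto
        with i show ?thesis by (auto simp: E0_def)
      qed (use i in \<open>auto simp: E0_def\<close>)
    next
      fix i assume "i \<in> E0 \<union> Suc ` E0"
      then show "i \<in> {..<2 * n}"
        unfolding E0_def by auto
    qed
    ultimately show "E \<in> steps (2 * n) {} {}"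
      using \<open>E \<in> {E0}\<close> by (auto simp: steps_def column_def dimer_cover_def dimers_def E0_def)
  qed
  with True show ?thesis by simp
next
  case False
  then have "steps (2 * n) R R = {}" by (auto simp: steps_def column_def)
  with False show ?thesis by simp
qed

lemma fock_trace_transfer_one: "fock_trace (2 * n) (transfer n) = 1"
proof -
  have "fock_trace (2 * n) (transfer n) = (\<Sum>R\<in>Pow {..<2 * n}. real (card (steps (2 * n) R R)))"
    unfolding fock_trace_def
  proof (rule sum.cong[OF refl])
    fix R assume R: "R \<in> Pow {..<2 * n}"
    have "app (transfer n) (point_fn R) R = (\<Sum>S\<in>Pow {..<2 * n}. real (card (steps (2 * n) R S)) * point_fn R S)"
      using R by (intro app_transfer) (auto simp: supported_point_fn)
    also have "\<dots> = (\<Sum>S\<in>Pow {..<2 * n}. if S = R then real (card (steps (2 * n) R R)) else 0)"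
      by (intro sum.cong) (auto simp: point_fn_def)
    also have "\<dots> = real (card (steps (2 * n) R R))"
      using R by simp
    finally show "app (transfer n) (point_fn R) R = real (card (steps (2 * n) R R))" .
  qed
  also have "\<dots> = (\<Sum>R\<in>Pow {..<2 * n}. if R = {} then 1 else 0)"
    by (intro sum.cong refl) (simp add: steps_self)
  also have "\<dots> = 1" by simp
  finally show ?thesis .
qed

section \<open>Perfect matchings as closed walks\<close>

text \<open>The horizontal edge of row \<open>j\<close> that enters column \<open>t\<close> from the left, which for \<open>t = 0\<close> is the wrap edge.\<close>

definition hedge :: "nat \<Rightarrow> nat \<Rightarrow> nat \<Rightarrow> bool \<times> (int \<times> int) set" where
  "hedge L t j = (if t = 0 then (True, {(0, int j), (int L - 1, int j)})
     else (False, {(int t - 1, int j), (int t, int j)}))"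

definition vedge :: "nat \<Rightarrow> nat \<Rightarrow> bool \<times> (int \<times> int) set" where
  "vedge t j = (False, {(int t, int j), (int t, int j + 1)})"

definition next_col :: "nat \<Rightarrow> nat \<Rightarrow> nat" where
  "next_col L t = (if Suc t = L then 0 else Suc t)"

text \<open>For \<open>L = 2\<close> the wrap edge is parallel to a grid edge, and only the boolean
  tag tells them apart.\<close>

lemma hedge_inj: "hedge L t j = hedge L t' j' \<longleftrightarrow> t = t' \<and> j = j'"
  by (auto simp: hedge_def doubleton_eq_iff)

lemma vedge_inj: "vedge t j = vedge t' j' \<longleftrightarrow> t = t' \<and> j = j'"
  by (auto simp: vedge_def doubleton_eq_iff)

lemma hedge_neq_vedge: "hedge L t j \<noteq> vedge t' j'" "vedge t' j' \<noteq> hedge L t j"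
  by (auto simp: hedge_def vedge_def doubleton_eq_iff)

lemma hedge_incident:
  assumes "t < L" "t' < L"
  shows "(int t, int j) \<in> snd (hedge L t' j') \<longleftrightarrow> j' = j \<and> (t' = t \<or> t' = next_col L t)"
  using assms by (auto simp: hedge_def next_col_def)

lemma vedge_incident: "(int t, int j) \<in> snd (vedge t' j') \<longleftrightarrow> t' = t \<and> (j = j' \<or> j = Suc j')"
  by (auto simp: vedge_def)

lemma card_hedge: "t < L \<Longrightarrow> card (snd (hedge L t j)) = 2 \<longleftrightarrow> L \<noteq> 1"
  by (auto simp: hedge_def card_insert_if)

lemma card_vedge: "card (snd (vedge t j)) = 2"
  by (auto simp: vedge_def)

lemma square_sum_eq_one_iff:
  fixes a b :: int
  shows "a\<^sup>2 + b\<^sup>2 = 1 \<longleftrightarrow> (a = 0 \<and> (b = 1 \<or> b = - 1)) \<or> (b = 0 \<and> (a = 1 \<or> a = - 1))"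
proof
  assume eq: "a\<^sup>2 + b\<^sup>2 = 1"
  show "(a = 0 \<and> (b = 1 \<or> b = - 1)) \<or> (b = 0 \<and> (a = 1 \<or> a = - 1))"
  proof (cases "a = 0")
    case True
    with eq show ?thesis by (simp add: power2_eq_1_iff)
  next
    case False
    then have "a\<^sup>2 \<ge> 1" using zero_less_power2[of a] by linarith
    with eq have "b\<^sup>2 \<le> 0" by linarith
    then have "b = 0" by simp
    with eq show ?thesis by (simp add: power2_eq_1_iff)
  qed
qed auto

lemma edges_cylinder:
  assumes "L \<ge> 1"
  shows "edges (cylinder L H) = {hedge L t j | t j. t < L \<and> j < H} \<union> {vedge t j | t j. t < L \<and> Suc j < H}"
    (is "_ = ?A \<union> ?B")
proof (intro equalityI subsetI)
  fix e assume "e \<in> edges (cylinder L H)"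
  then consider g where "e = (False, g)" "g \<in> grid_edges L H" | g where "e = (True, g)" "g \<in> wrap_edges L H"
    by (auto simp: cylinder_def)
  then show "e \<in> ?A \<union> ?B"
  proof cases
    case 1
    then obtain i j i' j' where g: "g = {(i, j), (i', j')}"
      and v: "(i, j) \<in> grid_vertices L H" "(i', j') \<in> grid_vertices L H"
      and d: "(i - i')\<^sup>2 + (j - j')\<^sup>2 = 1"
      by (auto simp: grid_edges_def)
    have H: "(False, {(int a, int b), (int a + 1, int b)}) \<in> ?A" if "Suc a < L" "b < H" for a b
    proof -
      have "(False, {(int a, int b), (int a + 1, int b)}) = hedge L (Suc a) b"
        by (simp add: hedge_def add.commute)
      with that show ?thesis by blast
    qed
    have V: "(False, {(int a, int b), (int a, int b + 1)}) \<in> ?B" if "a < L" "Suc b < H" for a b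
      using that by (auto simp: vedge_def)
    obtain a b a' b' where n: "i = int a" "j = int b" "i' = int a'" "j' = int b'"
      using v by (auto simp: grid_vertices_def dest!: zero_le_imp_eq_int)
    from d consider "i' = i + 1" "j' = j" | "i = i' + 1" "j' = j" | "i' = i" "j' = j + 1" | "i' = i" "j = j' + 1"
      unfolding square_sum_eq_one_iff by auto
    then show ?thesis
    proof cases
      case c: 1
      with v n H[of a b] show ?thesis by (auto simp: 1 g grid_vertices_def)
    next
      case c: 2
      with v n H[of a' b] show ?thesis by (auto simp: 1 g grid_vertices_def insert_commute)
    next
      case c: 3
      with v n V[of a b] show ?thesis by (auto simp: 1 g grid_vertices_def)
    next
      case c: 4
      with v n V[of a b'] show ?thesis by (auto simp: 1 g grid_vertices_def insert_commute)
    qed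
  next
    case 2
    then obtain j where g: "g = {(0, j), (int L - 1, j)}" "(0, j) \<in> grid_vertices L H"
      by (auto simp: wrap_edges_def)
    then obtain b where "j = int b" "b < H"
      by (auto simp: grid_vertices_def dest!: zero_le_imp_eq_int)
    with 2 g assms have "e = hedge L 0 b" "0 < L" by (auto simp: hedge_def)
    with \<open>b < H\<close> show ?thesis by blast
  qed
next
  fix e assume "e \<in> ?A \<union> ?B"
  then consider t j where "e = hedge L t j" "t < L" "j < H" | t j where "e = vedge t j" "t < L" "Suc j < H"
    by blast
  then show "e \<in> edges (cylinder L H)"
  proof cases
    case 1
    show ?thesis
    proof (cases "t = 0")
      case True
      with 1 assms show ?thesis
        by (auto simp: cylinder_def hedge_def wrap_edges_def grid_vertices_def)
    next
      case False
      have "{(int t - 1, int j), (int t, int j)} \<in> grid_edges L H"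
        unfolding grid_edges_def mem_Collect_eq
        by (rule exI[of _ "int t - 1"], rule exI[of _ "int j"], rule exI[of _ "int t"], rule exI[of _ "int j"])
          (use 1 False in \<open>auto simp: grid_vertices_def\<close>)
      with 1 False show ?thesis by (simp add: cylinder_def hedge_def)
    qed
  next
    case 2
    have "{(int t, int j), (int t, int j + 1)} \<in> grid_edges L H"
      unfolding grid_edges_def mem_Collect_eq
      by (rule exI[of _ "int t"], rule exI[of _ "int j"], rule exI[of _ "int t"], rule exI[of _ "int j + 1"])
        (use 2 in \<open>auto simp: grid_vertices_def\<close>)
    with 2 show ?thesis by (simp add: cylinder_def vedge_def)
  qed
qed

text \<open>Reading index \<open>L\<close> as 0 closes the walk that a matching describes.\<close>

definition hedges_at :: "nat \<Rightarrow> nat \<Rightarrow> (bool \<times> (int \<times> int) set) set \<Rightarrow> nat \<Rightarrow> nat set" where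
  "hedges_at L H S t = {j. j < H \<and> hedge L (if t = L then 0 else t) j \<in> S}"

definition vedges_at :: "(bool \<times> (int \<times> int) set) set \<Rightarrow> nat \<Rightarrow> nat set" where
  "vedges_at S t = {j. vedge t j \<in> S}"

lemma hedges_at_Suc: "hedges_at L H S (Suc t) = {j. j < H \<and> hedge L (next_col L t) j \<in> S}"
  by (simp add: hedges_at_def next_col_def)

section \<open>The matching condition at a single vertex\<close>

lemma ex1_insert: "a \<notin> V \<Longrightarrow> (\<exists>!e. e \<in> insert a V) \<longleftrightarrow> V = {}"
  by blast

text \<open>\<open>a\<close> and \<open>b\<close> will be the left and right edges of a vertex. They
  coincide for one column, so distinctness can be asked only when \<open>a\<close> is
  chosen.\<close>

lemma ex1_union_iff:
  assumes "a \<notin> V" "b \<notin> V" "a \<in> S \<Longrightarrow> a \<noteq> b"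
  shows "(\<exists>!e. e \<in> ({a, b} \<inter> S) \<union> V) \<longleftrightarrow>
    (a \<in> S \<or> b \<in> S \<or> V \<noteq> {}) \<and> \<not> (a \<in> S \<and> b \<in> S) \<and> \<not> (a \<in> S \<and> V \<noteq> {}) \<and>
    \<not> (b \<in> S \<and> V \<noteq> {}) \<and> \<not> (\<exists>e f. e \<in> V \<and> f \<in> V \<and> e \<noteq> f)"
proof (cases "a \<in> S")
  case True
  then have eq: "({a, b} \<inter> S) \<union> V = insert a ((if b \<in> S then {b} else {}) \<union> V)" by auto
  have "a \<notin> (if b \<in> S then {b} else {}) \<union> V" using assms True by auto
  then have "(\<exists>!e. e \<in> ({a, b} \<inter> S) \<union> V) \<longleftrightarrow> (if b \<in> S then {b} else {}) \<union> V = {}"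
    unfolding eq by (rule ex1_insert)
  also have "\<dots> \<longleftrightarrow> b \<notin> S \<and> V = {}" by simp
  finally have "(\<exists>!e. e \<in> ({a, b} \<inter> S) \<union> V) \<longleftrightarrow> b \<notin> S \<and> V = {}" .
  with True show ?thesis by (cases "V = {}") simp_all
next
  case a: False
  show ?thesis
  proof (cases "b \<in> S")
    case True
    with a have eq: "({a, b} \<inter> S) \<union> V = insert b V" by auto
    from assms(2) have "(\<exists>!e. e \<in> ({a, b} \<inter> S) \<union> V) \<longleftrightarrow> V = {}"
      unfolding eq by (rule ex1_insert)
    with a True show ?thesis by (cases "V = {}") simp_all
  next
    case False
    with a have eq: "({a, b} \<inter> S) \<union> V = V" by auto
    have "(\<exists>!e. e \<in> V) \<longleftrightarrow> V \<noteq> {} \<and> \<not> (\<exists>e f. e \<in> V \<and> f \<in> V \<and> e \<noteq> f)"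
      by blast
    then show ?thesis unfolding eq using a False by simp
  qed
qed

text \<open>A vertex meets a left and a right edge and at most two vertical ones. The last conjunct
  forbids both vertical edges at once, which the set \<open>dimer_cover\<close> cannot
  detect.\<close>

lemma unique_edge_iff:
  assumes S: "S \<subseteq> edges (cylinder L H)" and "L \<ge> 1" and t: "t < L" "j < H"
    and one: "L = 1 \<Longrightarrow> hedge L t j \<notin> S"
  shows "(\<exists>!e. e \<in> S \<and> (int t, int j) \<in> snd e) \<longleftrightarrow>
    (hedge L t j \<in> S \<or> hedge L (next_col L t) j \<in> S \<or> j \<in> dimer_cover (vedges_at S t)) \<and>
    \<not> (hedge L t j \<in> S \<and> hedge L (next_col L t) j \<in> S) \<and> \<not> (hedge L t j \<in> S \<and> j \<in> dimer_cover (vedges_at S t)) \<and>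
    \<not> (hedge L (next_col L t) j \<in> S \<and> j \<in> dimer_cover (vedges_at S t)) \<and> \<not> (\<exists>i. j = Suc i \<and> i \<in> vedges_at S t \<and> j \<in> vedges_at S t)"
    (is "?L \<longleftrightarrow> ?R")
proof -
  define I where "I = {e \<in> S. (int t, int j) \<in> snd e}"
  define V where "V = {vedge t i | i. (i = j \<or> Suc i = j) \<and> vedge t i \<in> S}"
  have next_col: "next_col L t < L" using t by (auto simp: next_col_def)
  have I: "I = ({hedge L t j, hedge L (next_col L t) j} \<inter> S) \<union> V"
  proof (intro equalityI subsetI)
    fix e assume e: "e \<in> I"
    then have "e \<in> edges (cylinder L H)" using S by (auto simp: I_def)
    then consider t' j' where "e = hedge L t' j'" "t' < L" | t' j' where "e = vedge t' j'"
      unfolding edges_cylinder[OF \<open>L \<ge> 1\<close>] by blast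
    then show "e \<in> ({hedge L t j, hedge L (next_col L t) j} \<inter> S) \<union> V"
    proof cases
      case 1
      with e t show ?thesis by (auto simp: I_def hedge_incident)
    next
      case 2
      with e show ?thesis by (auto simp: I_def V_def vedge_incident)
    qed
  next
    fix e assume "e \<in> ({hedge L t j, hedge L (next_col L t) j} \<inter> S) \<union> V"
    then show "e \<in> I"
      using t next_col by (auto simp: I_def V_def hedge_incident vedge_incident simp del: of_nat_Suc)
  qed
  have disj: "hedge L t' j' \<notin> V" for t' j'
    by (auto simp: V_def hedge_neq_vedge)
  have V_ne: "V \<noteq> {} \<longleftrightarrow> j \<in> dimer_cover (vedges_at S t)"
  proof -
    have "V \<noteq> {} \<longleftrightarrow> (\<exists>i. (i = j \<or> Suc i = j) \<and> vedge t i \<in> S)"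
      unfolding V_def by blast
    then show ?thesis by (auto simp: dimer_cover_def vedges_at_def)
  qed
  have V_two: "(\<exists>e f. e \<in> V \<and> f \<in> V \<and> e \<noteq> f) \<longleftrightarrow> (\<exists>i. j = Suc i \<and> i \<in> vedges_at S t \<and> j \<in> vedges_at S t)"
  proof
    assume "\<exists>e f. e \<in> V \<and> f \<in> V \<and> e \<noteq> f"
    then obtain e f where "e \<in> V" "f \<in> V" "e \<noteq> f" by blast
    moreover obtain i where "e = vedge t i" "i = j \<or> Suc i = j" "vedge t i \<in> S"
      using \<open>e \<in> V\<close> unfolding V_def by blast
    moreover obtain i' where "f = vedge t i'" "i' = j \<or> Suc i' = j" "vedge t i' \<in> S"
      using \<open>f \<in> V\<close> unfolding V_def by blast
    ultimately show "\<exists>i. j = Suc i \<and> i \<in> vedges_at S t \<and> j \<in> vedges_at S t"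
      by (auto simp: vedges_at_def)
  next
    assume "\<exists>i. j = Suc i \<and> i \<in> vedges_at S t \<and> j \<in> vedges_at S t"
    then obtain i where "j = Suc i" "vedge t i \<in> V" "vedge t j \<in> V"
      by (auto simp: V_def vedges_at_def)
    then show "\<exists>e f. e \<in> V \<and> f \<in> V \<and> e \<noteq> f"
      by (intro exI[of _ "vedge t i"] exI[of _ "vedge t j"]) (auto simp: vedge_inj)
  qed
  have hne: "hedge L t j \<noteq> hedge L (next_col L t) j" if "hedge L t j \<in> S"
  proof -
    have "L \<noteq> 1" using that one by auto
    then have "next_col L t \<noteq> t" by (auto simp: next_col_def)
    then show ?thesis by (simp add: hedge_inj)
  qed
  have "?L \<longleftrightarrow> (\<exists>!e. e \<in> I)" by (simp add: I_def)
  also note I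
  also note ex1_union_iff[OF disj disj hne]
  finally show ?thesis unfolding V_ne V_two .
qed

definition column_matching :: "nat \<Rightarrow> nat \<Rightarrow> (bool \<times> (int \<times> int) set) set \<Rightarrow> bool" where
  "column_matching L H S \<longleftrightarrow> S \<subseteq> edges (cylinder L H) \<and>
     (\<forall>t<L. vedges_at S t \<in> steps H (hedges_at L H S t) (hedges_at L H S (Suc t)))"

text \<open>The bound on \<open>E\<close> keeps all covered sites below \<open>H\<close>, so the set
  equations in \<open>column\<close> reduce to conditions at each site.\<close>

lemma steps_iff_exactly_one:
  assumes E: "E \<subseteq> {..<H - 1}"
  shows "E \<in> steps H {j. j < H \<and> P j} {j. j < H \<and> Q j} \<longleftrightarrow>
    (\<forall>j<H. (P j \<or> Q j \<or> j \<in> dimer_cover E) \<and> \<not> (P j \<and> Q j) \<and> \<not> (P j \<and> j \<in> dimer_cover E) \<and>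
      \<not> (Q j \<and> j \<in> dimer_cover E) \<and> \<not> (\<exists>i. j = Suc i \<and> i \<in> E \<and> j \<in> E))"
proof -
  have dimer_cover: "dimer_cover E \<subseteq> {..<H}" using E by (auto simp: dimer_cover_def)
  have "j < H" if "j \<in> E" for j using E that by auto
  then have d: "(\<forall>i\<in>E. Suc i \<notin> E) \<longleftrightarrow> (\<forall>j<H. \<not> (\<exists>i. j = Suc i \<and> i \<in> E \<and> j \<in> E))"
    by blast
  have c: "column H {j. j < H \<and> P j} E {j. j < H \<and> Q j} \<longleftrightarrow>
      (\<forall>j<H. (P j \<or> Q j \<or> j \<in> dimer_cover E) \<and> \<not> (P j \<and> Q j) \<and> \<not> (P j \<and> j \<in> dimer_cover E) \<and> \<not> (Q j \<and> j \<in> dimer_cover E))"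
  proof -
    have un: "{j. j < H \<and> P j} \<union> dimer_cover E \<union> {j. j < H \<and> Q j} = {..<H} \<longleftrightarrow> (\<forall>j<H. P j \<or> Q j \<or> j \<in> dimer_cover E)"
      using dimer_cover by blast
    have int: "{j. j < H \<and> P j} \<inter> {j. j < H \<and> Q j} = {} \<longleftrightarrow> (\<forall>j<H. \<not> (P j \<and> Q j))"
      "{j. j < H \<and> P j} \<inter> dimer_cover E = {} \<longleftrightarrow> (\<forall>j<H. \<not> (P j \<and> j \<in> dimer_cover E))"
      "dimer_cover E \<inter> {j. j < H \<and> Q j} = {} \<longleftrightarrow> (\<forall>j<H. \<not> (Q j \<and> j \<in> dimer_cover E))"
      by blast+
    show ?thesis unfolding column_def un int by blast
  qed
  have "E \<in> steps H {j. j < H \<and> P j} {j. j < H \<and> Q j} \<longleftrightarrow>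
      (\<forall>i\<in>E. Suc i \<notin> E) \<and> column H {j. j < H \<and> P j} E {j. j < H \<and> Q j}"
    using E by (simp add: steps_def dimers_def)
  then show ?thesis unfolding d c by blast
qed

lemma perfect_matching_iff_column_matching:
  assumes "L \<ge> 1"
  shows "perfect_matching (cylinder L H) S \<longleftrightarrow> column_matching L H S"
proof (cases "S \<subseteq> edges (cylinder L H)")
  case S: True
  have loops: "(\<forall>e\<in>S. card (snd e) = 2) \<longleftrightarrow> (L = 1 \<longrightarrow> (\<forall>j. hedge L 0 j \<notin> S))"
  proof
    assume "\<forall>e\<in>S. card (snd e) = 2"
    then show "L = 1 \<longrightarrow> (\<forall>j. hedge L 0 j \<notin> S)"
      using card_hedge[of 0 L] by auto
  next
    assume one: "L = 1 \<longrightarrow> (\<forall>j. hedge L 0 j \<notin> S)"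
    show "\<forall>e\<in>S. card (snd e) = 2"
    proof
      fix e assume "e \<in> S"
      then have "e \<in> edges (cylinder L H)" using S by auto
      then consider t' j' where "e = hedge L t' j'" "t' < L" | t' j' where "e = vedge t' j'"
        unfolding edges_cylinder[OF \<open>L \<ge> 1\<close>] by blast
      then show "card (snd e) = 2"
        using one \<open>e \<in> S\<close> card_hedge by cases (auto simp: card_vedge less_Suc_eq)
    qed
  qed
  have vert: "vertices (cylinder L H) = {(int t, int j) | t j. t < L \<and> j < H}"
  proof -
    have "(i, j) \<in> grid_vertices L H \<longleftrightarrow> (\<exists>a b. i = int a \<and> j = int b \<and> a < L \<and> b < H)" for i j
    proof
      assume "(i, j) \<in> grid_vertices L H"
      then show "\<exists>a b. i = int a \<and> j = int b \<and> a < L \<and> b < H"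
        by (intro exI[of _ "nat i"] exI[of _ "nat j"]) (auto simp: grid_vertices_def)
    qed (auto simp: grid_vertices_def)
    then show ?thesis by (auto simp: cylinder_def)
  qed
  have sub: "vedges_at S t \<subseteq> {..<H - 1}" for t
  proof
    fix j assume "j \<in> vedges_at S t"
    then have "vedge t j \<in> edges (cylinder L H)" using S by (auto simp: vedges_at_def)
    then show "j \<in> {..<H - 1}"
      unfolding edges_cylinder[OF \<open>L \<ge> 1\<close>] by (auto simp: vedge_inj hedge_neq_vedge)
  qed
  have col: "(\<forall>j<H. \<exists>!e. e \<in> S \<and> (int t, int j) \<in> snd e) \<longleftrightarrow>
      vedges_at S t \<in> steps H (hedges_at L H S t) (hedges_at L H S (Suc t))"
    if "t < L" "L = 1 \<longrightarrow> (\<forall>j. hedge L 0 j \<notin> S)" for t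
  proof -
    have one: "L = 1 \<Longrightarrow> hedge L t j \<notin> S" for j using that by auto
    have h: "hedges_at L H S t = {j. j < H \<and> hedge L t j \<in> S}"
      using that by (simp add: hedges_at_def)
    show ?thesis
      unfolding h hedges_at_Suc steps_iff_exactly_one[OF sub]
      by (intro all_cong unique_edge_iff[OF S assms that(1) _ one])
  qed
  \<comment> \<open>With one column an edge entering from the left also leaves to the right, so the
    disjointness in \<open>column\<close> already excludes loops.\<close>
  have dis: "L = 1 \<longrightarrow> (\<forall>j. hedge L 0 j \<notin> S)"
    if "\<forall>t<L. vedges_at S t \<in> steps H (hedges_at L H S t) (hedges_at L H S (Suc t))"
  proof (intro impI allI notI)
    fix j assume "L = 1" "hedge L 0 j \<in> S"
    moreover from this have "j < H"
      using S unfolding edges_cylinder[OF \<open>L \<ge> 1\<close>] by (auto simp: hedge_inj hedge_neq_vedge)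
    ultimately have "j \<in> hedges_at L H S 0 \<inter> hedges_at L H S (Suc 0)"
      by (simp add: hedges_at_def)
    with that \<open>L = 1\<close> show False by (auto simp: steps_def column_def)
  qed
  have "perfect_matching (cylinder L H) S \<longleftrightarrow> (\<forall>e\<in>S. card (snd e) = 2) \<and>
      (\<forall>t<L. \<forall>j<H. \<exists>!e. e \<in> S \<and> (int t, int j) \<in> snd e)"
  proof -
    have "endpoints (cylinder L H) = snd" by (simp add: cylinder_def)
    then have "perfect_matching (cylinder L H) S \<longleftrightarrow> (\<forall>e\<in>S. card (snd e) = 2) \<and>
        (\<forall>v\<in>{(int t, int j) | t j. t < L \<and> j < H}. \<exists>!e. e \<in> S \<and> v \<in> snd e)"
      by (simp only: perfect_matching_def vert S simp_thms)
    also have "(\<forall>v\<in>{(int t, int j) | t j. t < L \<and> j < H}. Q v) \<longleftrightarrow> (\<forall>t<L. \<forall>j<H. Q (int t, int j))"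
      for Q :: "int \<times> int \<Rightarrow> bool" by blast
    finally show ?thesis .
  qed
  also have "\<dots> \<longleftrightarrow> column_matching L H S"
  proof
    assume "(\<forall>e\<in>S. card (snd e) = 2) \<and> (\<forall>t<L. \<forall>j<H. \<exists>!e. e \<in> S \<and> (int t, int j) \<in> snd e)"
    then show "column_matching L H S" unfolding loops column_matching_def using S col by simp
  next
    assume "column_matching L H S"
    then show "(\<forall>e\<in>S. card (snd e) = 2) \<and> (\<forall>t<L. \<forall>j<H. \<exists>!e. e \<in> S \<and> (int t, int j) \<in> snd e)"
      unfolding loops column_matching_def using S col dis by simp
  qed
  finally show ?thesis .
qed (simp add: perfect_matching_def column_matching_def)

text \<open>Only \<open>t < L\<close> is read, since \<open>s L\<close> would repeat the wrap
  edges.\<close>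

definition edge_set :: "nat \<Rightarrow> (nat \<Rightarrow> nat set) \<Rightarrow> (nat \<Rightarrow> nat set) \<Rightarrow> (bool \<times> (int \<times> int) set) set" where
  "edge_set L s E = {hedge L t j | t j. t < L \<and> j \<in> s t} \<union> {vedge t j | t j. t < L \<and> j \<in> E t}"

lemma num_perfect_matchings_configs:
  assumes "L \<ge> 1"
  shows "num_perfect_matchings (cylinder L H) = card (configs L H)"
proof -
  define F where "F S = (restrict (hedges_at L H S) {..L}, restrict (vedges_at S) {..<L})" for S
  have "bij_betw F {S. column_matching L H S} (configs L H)"
  proof (rule bij_betw_byWitness[where f' = "\<lambda>(s, E). edge_set L s E"])
    show "\<forall>S\<in>{S. column_matching L H S}. (\<lambda>(s, E). edge_set L s E) (F S) = S"
    proof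
      fix S assume "S \<in> {S. column_matching L H S}"
      then have S: "S \<subseteq> edges (cylinder L H)" by (simp add: column_matching_def)
      have "edge_set L (restrict (hedges_at L H S) {..L}) (restrict (vedges_at S) {..<L}) =
          {hedge L t j | t j. t < L \<and> j < H \<and> hedge L t j \<in> S} \<union> {vedge t j | t j. t < L \<and> vedge t j \<in> S}"
        unfolding edge_set_def by (auto simp: hedges_at_def vedges_at_def)
      also have "\<dots> = S"
        using S unfolding edges_cylinder[OF assms] by blast
      finally show "(\<lambda>(s, E). edge_set L s E) (F S) = S" by (simp add: F_def)
    qed
    have conf: "F (edge_set L s E) = (s, E) \<and> column_matching L H (edge_set L s E)" if "(s, E) \<in> configs L H" for s E
    proof -
      from that have s: "s \<in> {..L} \<rightarrow>\<^sub>E Pow {..<H}" "s L = s 0"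
        and E: "E \<in> (\<Pi>\<^sub>E t\<in>{..<L}. steps H (s t) (s (Suc t)))"
        by (auto simp: configs_def)
      have hs: "hedges_at L H (edge_set L s E) t = s t" if "t \<le> L" for t
      proof -
        have "s t \<subseteq> {..<H}" using s that by (auto simp: PiE_iff)
        then show ?thesis
          using that assms s(2) by (auto simp: hedges_at_def edge_set_def hedge_inj hedge_neq_vedge)
      qed
      have vs: "vedges_at (edge_set L s E) t = E t" if "t < L" for t
        using that by (auto simp: vedges_at_def edge_set_def vedge_inj hedge_neq_vedge)
      have "F (edge_set L s E) = (s, E)"
        using s(1) E hs vs by (auto simp: F_def fun_eq_iff PiE_iff extensional_def)
      moreover have "edge_set L s E \<subseteq> edges (cylinder L H)"
      proof -
        have "s t \<subseteq> {..<H}" "E t \<subseteq> {..<H - 1}" if "t < L" for t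
          using s E that by (auto simp: PiE_iff steps_def dimers_def)
        then show ?thesis
          unfolding edges_cylinder[OF assms] edge_set_def by fastforce
      qed
      moreover have "E t \<in> steps H (s t) (s (Suc t))" if "t < L" for t
        using E that by (auto simp: PiE_iff)
      ultimately show ?thesis by (simp add: column_matching_def hs vs)
    qed
    then show "\<forall>c\<in>configs L H. F ((\<lambda>(s, E). edge_set L s E) c) = c"
      "(\<lambda>(s, E). edge_set L s E) ` configs L H \<subseteq> {S. column_matching L H S}"
      by auto
    show "F ` {S. column_matching L H S} \<subseteq> configs L H"
    proof (intro image_subsetI)
      fix S assume "S \<in> {S. column_matching L H S}"
      then have "vedges_at S t \<in> steps H (hedges_at L H S t) (hedges_at L H S (Suc t))" if "t < L" for t
        using that by (simp add: column_matching_def)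
      moreover have "hedges_at L H S L = hedges_at L H S 0" by (simp add: hedges_at_def)
      ultimately show "F S \<in> configs L H"
        by (auto simp: F_def configs_def PiE_iff hedges_at_def)
    qed
  qed
  then show ?thesis
    unfolding num_perfect_matchings_def perfect_matching_iff_column_matching[OF assms]
    by (rule bij_betw_same_card)
qed

theorem theorem7p2:
  fixes m n :: nat
  shows "real (num_perfect_matchings (cylinder (2 * m + 1) (2 * n))) =
    (\<Prod>k = 1..n. \<Prod>j\<in>{j::nat. odd j \<and> j \<le> 2 * m + 1}.
       4 * (cos (real j * pi / (4 * real m + 2)))\<^sup>2 +
       4 * (cos (real k * pi / (2 * real n + 1)))\<^sup>2)"
proof -
  define \<mu> where "\<mu> k = 2 * cos (mode_angle n k)" for k
  have "\<exists>s. s * s = 1 \<and> (\<forall>L. odd L \<longrightarrow> fock_trace (2 * n) (transfer n ^ L) = s * (\<Prod>k<n. lucas (\<mu> k) L))"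
    unfolding transfer_def
  proof (rule fock_trace_transfer[of n "sine_matrix n" \<mu>])
    show "(\<Sum>k<n. \<mu> k * (sine_matrix n (2 * k) (2 * l) * sine_matrix n (2 * k + 1) (2 * m + 1))) =
        of_bool (l = m) - of_bool (l = Suc m)" if "l < n" "m < n" for l m
      unfolding \<mu>_def by (rule sine_matrix_singular[OF that])
  qed (use sine_matrix_rows sine_matrix_cols sine_matrix_parity in blast)+
  then obtain s where s: "s * s = 1"
    "\<And>L. odd L \<Longrightarrow> fock_trace (2 * n) (transfer n ^ L) = s * (\<Prod>k<n. lucas (\<mu> k) L)"
    by blast
  have one: "1 = s * (\<Prod>k<n. \<mu> k)"
    using s(2)[of 1] by (simp add: fock_trace_transfer_one)
  have "real (num_perfect_matchings (cylinder (2 * m + 1) (2 * n))) =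
      fock_trace (2 * n) (transfer n ^ (2 * m + 1))"
    by (simp only: num_perfect_matchings_configs fock_trace_transfer_power le_add2)
  \<comment> \<open>A factor 1 is inserted in the form given by \<open>one\<close>: it squares the
    sign away and supplies the \<open>\<mu> k\<close> that \<open>lucas_product\<close>
    expects.\<close>
  also have "\<dots> = (s * (\<Prod>k<n. \<mu> k)) * (s * (\<Prod>k<n. lucas (\<mu> k) (2 * m + 1)))"
    unfolding one[symmetric] by (subst s(2)) simp_all
  also have "\<dots> = (s * s) * (\<Prod>k<n. \<mu> k * lucas (\<mu> k) (2 * m + 1))"
    by (simp only: prod.distrib mult_ac)
  also have "\<dots> = (\<Prod>k<n. \<mu> k * lucas (\<mu> k) (2 * m + 1))"
    by (simp only: s(1) mult_1)
  also have "\<dots> = (\<Prod>k<n. \<Prod>j\<in>{j::nat. odd j \<and> j \<le> 2 * m + 1}.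
       4 * (cos (real j * pi / (4 * real m + 2)))\<^sup>2 + (\<mu> k)\<^sup>2)"
    by (simp only: lucas_product)
  also have "\<dots> = (\<Prod>k = 1..n. \<Prod>j\<in>{j::nat. odd j \<and> j \<le> 2 * m + 1}.
       4 * (cos (real j * pi / (4 * real m + 2)))\<^sup>2 +
       4 * (cos (real k * pi / (2 * real n + 1)))\<^sup>2)"
    by (rule prod.reindex_bij_witness[of _ "\<lambda>k. k - 1" Suc])
      (auto simp: \<mu>_def mode_angle_def power_mult_distrib simp del: of_nat_Suc)
  finally show ?thesis .
qed

end
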